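(* Let $\mathbf C,\mathbf D,\mathbf E$ be monoidal categories ($\mathbf C,\mathbf D$ strict), let $F\colon\mathbf D\to\mathbf C$ be left adjoint to a strong monoidal functor $U\colon\mathbf C\to\mathbf D$, and suppose this adjunction splits as $F=F_1F_2$, $U=U_2U_1$ for adjunctions $F_1\dashv U_1$ (with $F_1\colon\mathbf E\to\mathbf C$, $U_1\colon\mathbf C\to\mathbf E$) and $F_2\dashv U_2$ (with $F_2\colon\mathbf D\to\mathbf E$, $U_2\colon\mathbf E\to\mathbf D$) with strong monoidal right adjoints, such that the monoidal structures satisfy $\lambda=U_2\lambda_1\cdot\lambda_2U_1$. Let $a\colon(UA)^{\otimes k}\to(UB)^{\otimes n}$ be a morphism in $\mathbf D$ and let $\rho\colon\widehat B^{\widehat\otimes n}\to T\widehat A^{\widehat\otimes k}$ be its dual morphism in $\widehat{\mathbf C}$. Then the following are equivalent: (1) $a$ lifts along $U_2$, that is, $a=\lambda_2^{-1}\cdot U_2b\cdot\lambda_2$ for some $b\colon(U_1A)^{\otimes k}\to(U_1B)^{\otimes n}$; (2) $\rho$ factorizes through the monad morphism $\widehat F_1\hat\varepsilon_2\widehat U_1\colon T_1\to T$, where $T_1=\widehat F_1\widehat U_1$; that is, $\rho=\widehat F_1\hat\varepsilon_2\widehat U_1\cdot\sigma$ for some $\sigma\colon\widehat B^{\widehat\otimes n}\to T_1\widehat A^{\widehat\otimes k}$.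
   Context: For each of the categories involved a dually equivalent category is fixed, denoted $\widehat{\mathbf C},\widehat{\mathbf D},\widehat{\mathbf E}$, with dual tensor $\widehat\otimes$; both contravariant equivalences are written $\widehat{(-)}$, and the dual of a functor $G$ is $\widehat G=\widehat{(-)}\cdot G\cdot\widehat{(-)}$. $T=\widehat F\widehat U$ is the monad on $\widehat{\mathbf C}$ dual to the comonad $FU$; $\varepsilon_2$ is the counit of $F_2\dashv U_2$, and $\hat\varepsilon_2$ its dual. The isomorphisms $\lambda\colon UX\otimes UY\cong U(X\otimes Y)$, and similarly $\lambda_1,\lambda_2$ for $U_1,U_2$, are the strong monoidal structures, extended to all finite arities. Dual of a morphism: given $a\colon(UA)^{\otimes k}\to(UB)^{\otimes n}$, put $h=\lambda\cdot a\cdot\lambda^{-1}\colon U(A^{\otimes k})\to U(B^{\otimes n})$ and let $h^+\colon FU(A^{\otimes k})\to B^{\otimes n}$ be its adjoint transpose under $F\dashv U$. The dual of $a$ is $\rho=\widehat{h^+}\colon\widehat B^{\widehat\otimes n}\to T\widehat A^{\widehat\otimes k}$. *)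

theory Defs
  imports Main
begin

section \<open>Categories, functors, natural transformations, adjunctions\<close>

record ('o, 'a) cat =
  Obj :: "'o set"
  Arr :: "'a set"
  Src :: "'a \<Rightarrow> 'o"
  Tgt :: "'a \<Rightarrow> 'o"
  Ide :: "'o \<Rightarrow> 'a"
  Cmp :: "'a \<Rightarrow> 'a \<Rightarrow> 'a" (infixr "\<bullet>\<index>" 65)

definition Hom :: "('o, 'a, 'x) cat_scheme \<Rightarrow> 'o \<Rightarrow> 'o \<Rightarrow> 'a set" where
  "Hom C X Y = {f \<in> Arr C. Src C f = X \<and> Tgt C f = Y}"

locale category =
  fixes C :: "('o, 'a, 'x) cat_scheme"
  assumes src_obj: "f \<in> Arr C \<Longrightarrow> Src C f \<in> Obj C"
    and tgt_obj: "f \<in> Arr C \<Longrightarrow> Tgt C f \<in> Obj C"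
    and ide_hom: "X \<in> Obj C \<Longrightarrow> Ide C X \<in> Hom C X X"
    and cmp_hom: "\<lbrakk>f \<in> Hom C X Y; g \<in> Hom C Y Z\<rbrakk> \<Longrightarrow> g \<bullet>\<^bsub>C\<^esub> f \<in> Hom C X Z"
    and ide_left: "f \<in> Hom C X Y \<Longrightarrow> Ide C Y \<bullet>\<^bsub>C\<^esub> f = f"
    and ide_right: "f \<in> Hom C X Y \<Longrightarrow> f \<bullet>\<^bsub>C\<^esub> Ide C X = f"
    and cmp_assoc: "\<lbrakk>f \<in> Hom C W X; g \<in> Hom C X Y; h \<in> Hom C Y Z\<rbrakk>
      \<Longrightarrow> (h \<bullet>\<^bsub>C\<^esub> g) \<bullet>\<^bsub>C\<^esub> f = h \<bullet>\<^bsub>C\<^esub> (g \<bullet>\<^bsub>C\<^esub> f)"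

definition inverse_arrows :: "('o, 'a, 'x) cat_scheme \<Rightarrow> 'a \<Rightarrow> 'a \<Rightarrow> bool" where
  "inverse_arrows C f g \<longleftrightarrow>
     f \<in> Arr C \<and> g \<in> Hom C (Tgt C f) (Src C f) \<and>
     g \<bullet>\<^bsub>C\<^esub> f = Ide C (Src C f) \<and> f \<bullet>\<^bsub>C\<^esub> g = Ide C (Tgt C f)"

definition is_iso :: "('o, 'a, 'x) cat_scheme \<Rightarrow> 'a \<Rightarrow> bool" where
  "is_iso C f \<longleftrightarrow> (\<exists>g. inverse_arrows C f g)"

definition inv_arr :: "('o, 'a, 'x) cat_scheme \<Rightarrow> 'a \<Rightarrow> 'a" where
  "inv_arr C f = (THE g. inverse_arrows C f g)"

definition op_cat :: "('o, 'a, 'x) cat_scheme \<Rightarrow> ('o, 'a, 'x) cat_scheme" where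
  "op_cat C = C\<lparr>Src := Tgt C, Tgt := Src C, Cmp := (\<lambda>g f. f \<bullet>\<^bsub>C\<^esub> g)\<rparr>"

record ('o, 'a, 'p, 'b) fctr =
  FO :: "'o \<Rightarrow> 'p"
  FA :: "'a \<Rightarrow> 'b"

definition fid :: "('o, 'a, 'o, 'a) fctr" where
  "fid = \<lparr>FO = (\<lambda>X. X), FA = (\<lambda>f. f)\<rparr>"

definition fcomp ::
  "('p, 'b, 'q, 'c) fctr \<Rightarrow> ('o, 'a, 'p, 'b) fctr \<Rightarrow> ('o, 'a, 'q, 'c) fctr"
  (infixr "\<cdot>\<^sub>F" 75) where
  "H \<cdot>\<^sub>F G = \<lparr>FO = (\<lambda>X. FO H (FO G X)), FA = (\<lambda>f. FA H (FA G f))\<rparr>"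

locale is_functor = source: category C + target: category K
  for C :: "('o, 'a, 'x) cat_scheme" and K :: "('p, 'b, 'y) cat_scheme" +
  fixes G :: "('o, 'a, 'p, 'b) fctr"
  assumes fobj: "X \<in> Obj C \<Longrightarrow> FO G X \<in> Obj K"
    and fhom: "f \<in> Hom C X Y \<Longrightarrow> FA G f \<in> Hom K (FO G X) (FO G Y)"
    and fide: "X \<in> Obj C \<Longrightarrow> FA G (Ide C X) = Ide K (FO G X)"
    and fcmp: "\<lbrakk>f \<in> Hom C X Y; g \<in> Hom C Y Z\<rbrakk>
      \<Longrightarrow> FA G (g \<bullet>\<^bsub>C\<^esub> f) = FA G g \<bullet>\<^bsub>K\<^esub> FA G f"

text \<open>The maps of a functor are unconstrained outside the category, so equality of functors
  is equality on objects and arrows of the source.\<close>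

definition functor_eq ::
  "('o, 'a, 'x) cat_scheme \<Rightarrow> ('o, 'a, 'p, 'b) fctr \<Rightarrow> ('o, 'a, 'p, 'b) fctr \<Rightarrow> bool" where
  "functor_eq C G H \<longleftrightarrow>
     (\<forall>X \<in> Obj C. FO G X = FO H X) \<and> (\<forall>f \<in> Arr C. FA G f = FA H f)"

locale nat_trans = domain: is_functor C K G + codomain: is_functor C K H
  for C :: "('o, 'a, 'x) cat_scheme" and K :: "('p, 'b, 'y) cat_scheme"
    and G H :: "('o, 'a, 'p, 'b) fctr" +
  fixes t :: "'o \<Rightarrow> 'b"
  assumes component: "X \<in> Obj C \<Longrightarrow> t X \<in> Hom K (FO G X) (FO H X)"
    and naturality: "f \<in> Hom C X Y \<Longrightarrow> t Y \<bullet>\<^bsub>K\<^esub> FA G f = FA H f \<bullet>\<^bsub>K\<^esub> t X"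

locale nat_iso = nat_trans +
  assumes component_iso: "X \<in> Obj C \<Longrightarrow> is_iso K (t X)"

locale adjunction =
  unit: nat_trans D D fid "U \<cdot>\<^sub>F F" eta + counit: nat_trans C C "F \<cdot>\<^sub>F U" fid eps +
  left: is_functor D C F + right: is_functor C D U
  for D :: "('o, 'a, 'x) cat_scheme" and C :: "('p, 'b, 'y) cat_scheme"
    and F :: "('o, 'a, 'p, 'b) fctr" and U :: "('p, 'b, 'o, 'a) fctr"
    and eta :: "'o \<Rightarrow> 'a" and eps :: "'p \<Rightarrow> 'b" +
  assumes triangle_left: "X \<in> Obj D \<Longrightarrow> eps (FO F X) \<bullet>\<^bsub>C\<^esub> FA F (eta X) = Ide C (FO F X)"
    and triangle_right: "Y \<in> Obj C \<Longrightarrow> FA U (eps Y) \<bullet>\<^bsub>D\<^esub> eta (FO U Y) = Ide D (FO U Y)"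

text \<open>The adjoint transpose \<open>h\<^sup>+ : F X \<rightarrow> Y\<close> of \<open>h : X \<rightarrow> U Y\<close>.\<close>

definition transpose ::
  "('p, 'b, 'y) cat_scheme \<Rightarrow> ('o, 'a, 'p, 'b) fctr \<Rightarrow> ('p \<Rightarrow> 'b) \<Rightarrow> 'p \<Rightarrow> 'a \<Rightarrow> 'b" where
  "transpose C F eps Y h = eps Y \<bullet>\<^bsub>C\<^esub> FA F h"

text \<open>The adjunction \<open>F \<stileturn> U\<close> is the composite of \<open>F1 \<stileturn> U1\<close> and \<open>F2 \<stileturn> U2\<close>: not only do the
  functors compose, the unit and counit are those of the composite adjunction.\<close>

definition adjunction_splits where
  "adjunction_splits D C F U eta eps F1 U1 eta1 eps1 F2 U2 eta2 eps2 \<longleftrightarrow>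
     functor_eq D F (F1 \<cdot>\<^sub>F F2) \<and> functor_eq C U (U2 \<cdot>\<^sub>F U1) \<and>
     (\<forall>X \<in> Obj D. eta X = FA U2 (eta1 (FO F2 X)) \<bullet>\<^bsub>D\<^esub> eta2 X) \<and>
     (\<forall>Y \<in> Obj C. eps Y = eps1 Y \<bullet>\<^bsub>C\<^esub> FA F1 (eps2 (FO U1 Y)))"


section \<open>Monoidal categories and strong monoidal functors\<close>

record ('o, 'a) mcat = "('o, 'a) cat" +
  TenO :: "'o \<Rightarrow> 'o \<Rightarrow> 'o" (infixl "\<otimes>\<index>" 70)
  TenA :: "'a \<Rightarrow> 'a \<Rightarrow> 'a" (infixl "\<boxtimes>\<index>" 70)
  Unt :: "'o"
  Asc :: "'o \<Rightarrow> 'o \<Rightarrow> 'o \<Rightarrow> 'a"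
  Lun :: "'o \<Rightarrow> 'a"
  Run :: "'o \<Rightarrow> 'a"

locale monoidal_category = category C
  for C :: "('o, 'a, 'x) mcat_scheme" +
  assumes unt_obj: "Unt C \<in> Obj C"
    and ten_obj: "\<lbrakk>X \<in> Obj C; Y \<in> Obj C\<rbrakk> \<Longrightarrow> X \<otimes>\<^bsub>C\<^esub> Y \<in> Obj C"
    and ten_hom: "\<lbrakk>f \<in> Hom C X X'; g \<in> Hom C Y Y'\<rbrakk>
      \<Longrightarrow> f \<boxtimes>\<^bsub>C\<^esub> g \<in> Hom C (X \<otimes>\<^bsub>C\<^esub> Y) (X' \<otimes>\<^bsub>C\<^esub> Y')"
    and ten_ide: "\<lbrakk>X \<in> Obj C; Y \<in> Obj C\<rbrakk>
      \<Longrightarrow> Ide C X \<boxtimes>\<^bsub>C\<^esub> Ide C Y = Ide C (X \<otimes>\<^bsub>C\<^esub> Y)"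
    and ten_cmp: "\<lbrakk>f \<in> Hom C X X'; f' \<in> Hom C X' X''; g \<in> Hom C Y Y'; g' \<in> Hom C Y' Y''\<rbrakk>
      \<Longrightarrow> (f' \<bullet>\<^bsub>C\<^esub> f) \<boxtimes>\<^bsub>C\<^esub> (g' \<bullet>\<^bsub>C\<^esub> g) = (f' \<boxtimes>\<^bsub>C\<^esub> g') \<bullet>\<^bsub>C\<^esub> (f \<boxtimes>\<^bsub>C\<^esub> g)"
    and asc_hom: "\<lbrakk>X \<in> Obj C; Y \<in> Obj C; Z \<in> Obj C\<rbrakk>
      \<Longrightarrow> Asc C X Y Z \<in> Hom C ((X \<otimes>\<^bsub>C\<^esub> Y) \<otimes>\<^bsub>C\<^esub> Z) (X \<otimes>\<^bsub>C\<^esub> (Y \<otimes>\<^bsub>C\<^esub> Z))"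
    and asc_iso: "\<lbrakk>X \<in> Obj C; Y \<in> Obj C; Z \<in> Obj C\<rbrakk> \<Longrightarrow> is_iso C (Asc C X Y Z)"
    and asc_nat: "\<lbrakk>f \<in> Hom C X X'; g \<in> Hom C Y Y'; h \<in> Hom C Z Z'\<rbrakk>
      \<Longrightarrow> Asc C X' Y' Z' \<bullet>\<^bsub>C\<^esub> ((f \<boxtimes>\<^bsub>C\<^esub> g) \<boxtimes>\<^bsub>C\<^esub> h)
        = (f \<boxtimes>\<^bsub>C\<^esub> (g \<boxtimes>\<^bsub>C\<^esub> h)) \<bullet>\<^bsub>C\<^esub> Asc C X Y Z"
    and lun_hom: "X \<in> Obj C \<Longrightarrow> Lun C X \<in> Hom C (Unt C \<otimes>\<^bsub>C\<^esub> X) X"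
    and lun_iso: "X \<in> Obj C \<Longrightarrow> is_iso C (Lun C X)"
    and lun_nat: "f \<in> Hom C X Y
      \<Longrightarrow> Lun C Y \<bullet>\<^bsub>C\<^esub> (Ide C (Unt C) \<boxtimes>\<^bsub>C\<^esub> f) = f \<bullet>\<^bsub>C\<^esub> Lun C X"
    and run_hom: "X \<in> Obj C \<Longrightarrow> Run C X \<in> Hom C (X \<otimes>\<^bsub>C\<^esub> Unt C) X"
    and run_iso: "X \<in> Obj C \<Longrightarrow> is_iso C (Run C X)"
    and run_nat: "f \<in> Hom C X Y
      \<Longrightarrow> Run C Y \<bullet>\<^bsub>C\<^esub> (f \<boxtimes>\<^bsub>C\<^esub> Ide C (Unt C)) = f \<bullet>\<^bsub>C\<^esub> Run C X"
    and pentagon: "\<lbrakk>W \<in> Obj C; X \<in> Obj C; Y \<in> Obj C; Z \<in> Obj C\<rbrakk>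
      \<Longrightarrow> (Ide C W \<boxtimes>\<^bsub>C\<^esub> Asc C X Y Z) \<bullet>\<^bsub>C\<^esub> Asc C W (X \<otimes>\<^bsub>C\<^esub> Y) Z \<bullet>\<^bsub>C\<^esub> (Asc C W X Y \<boxtimes>\<^bsub>C\<^esub> Ide C Z)
        = Asc C W X (Y \<otimes>\<^bsub>C\<^esub> Z) \<bullet>\<^bsub>C\<^esub> Asc C (W \<otimes>\<^bsub>C\<^esub> X) Y Z"
    and triangle: "\<lbrakk>X \<in> Obj C; Y \<in> Obj C\<rbrakk>
      \<Longrightarrow> (Ide C X \<boxtimes>\<^bsub>C\<^esub> Lun C Y) \<bullet>\<^bsub>C\<^esub> Asc C X (Unt C) Y = Run C X \<boxtimes>\<^bsub>C\<^esub> Ide C Y"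

locale strict_monoidal_category = monoidal_category +
  assumes strict_asc_obj: "\<lbrakk>X \<in> Obj C; Y \<in> Obj C; Z \<in> Obj C\<rbrakk>
      \<Longrightarrow> (X \<otimes>\<^bsub>C\<^esub> Y) \<otimes>\<^bsub>C\<^esub> Z = X \<otimes>\<^bsub>C\<^esub> (Y \<otimes>\<^bsub>C\<^esub> Z)"
    and strict_lun_obj: "X \<in> Obj C \<Longrightarrow> Unt C \<otimes>\<^bsub>C\<^esub> X = X"
    and strict_run_obj: "X \<in> Obj C \<Longrightarrow> X \<otimes>\<^bsub>C\<^esub> Unt C = X"
    and strict_asc: "\<lbrakk>X \<in> Obj C; Y \<in> Obj C; Z \<in> Obj C\<rbrakk>
      \<Longrightarrow> Asc C X Y Z = Ide C (X \<otimes>\<^bsub>C\<^esub> (Y \<otimes>\<^bsub>C\<^esub> Z))"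
    and strict_lun: "X \<in> Obj C \<Longrightarrow> Lun C X = Ide C X"
    and strict_run: "X \<in> Obj C \<Longrightarrow> Run C X = Ide C X"

definition op_mcat :: "('o, 'a, 'x) mcat_scheme \<Rightarrow> ('o, 'a, 'x) mcat_scheme" where
  "op_mcat C = (op_cat C)\<lparr>
     Asc := (\<lambda>X Y Z. inv_arr C (Asc C X Y Z)),
     Lun := (\<lambda>X. inv_arr C (Lun C X)),
     Run := (\<lambda>X. inv_arr C (Run C X))\<rparr>"

locale strong_monoidal_functor =
  source: monoidal_category C + target: monoidal_category K + is_functor C K G
  for C :: "('o, 'a, 'x) mcat_scheme" and K :: "('p, 'b, 'y) mcat_scheme"
    and G :: "('o, 'a, 'p, 'b) fctr" +
  fixes m :: "'o \<Rightarrow> 'o \<Rightarrow> 'b" and m0 :: 'b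
  assumes m_hom: "\<lbrakk>X \<in> Obj C; Y \<in> Obj C\<rbrakk>
      \<Longrightarrow> m X Y \<in> Hom K (FO G X \<otimes>\<^bsub>K\<^esub> FO G Y) (FO G (X \<otimes>\<^bsub>C\<^esub> Y))"
    and m_iso: "\<lbrakk>X \<in> Obj C; Y \<in> Obj C\<rbrakk> \<Longrightarrow> is_iso K (m X Y)"
    and m_nat: "\<lbrakk>f \<in> Hom C X X'; g \<in> Hom C Y Y'\<rbrakk>
      \<Longrightarrow> m X' Y' \<bullet>\<^bsub>K\<^esub> (FA G f \<boxtimes>\<^bsub>K\<^esub> FA G g) = FA G (f \<boxtimes>\<^bsub>C\<^esub> g) \<bullet>\<^bsub>K\<^esub> m X Y"
    and m0_hom: "m0 \<in> Hom K (Unt K) (FO G (Unt C))"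
    and m0_iso: "is_iso K m0"
    and m_asc: "\<lbrakk>X \<in> Obj C; Y \<in> Obj C; Z \<in> Obj C\<rbrakk>
      \<Longrightarrow> FA G (Asc C X Y Z) \<bullet>\<^bsub>K\<^esub> m (X \<otimes>\<^bsub>C\<^esub> Y) Z \<bullet>\<^bsub>K\<^esub> (m X Y \<boxtimes>\<^bsub>K\<^esub> Ide K (FO G Z))
        = m X (Y \<otimes>\<^bsub>C\<^esub> Z) \<bullet>\<^bsub>K\<^esub> (Ide K (FO G X) \<boxtimes>\<^bsub>K\<^esub> m Y Z)
            \<bullet>\<^bsub>K\<^esub> Asc K (FO G X) (FO G Y) (FO G Z)"
    and m_lun: "X \<in> Obj C
      \<Longrightarrow> FA G (Lun C X) \<bullet>\<^bsub>K\<^esub> m (Unt C) X \<bullet>\<^bsub>K\<^esub> (m0 \<boxtimes>\<^bsub>K\<^esub> Ide K (FO G X)) = Lun K (FO G X)"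
    and m_run: "X \<in> Obj C
      \<Longrightarrow> FA G (Run C X) \<bullet>\<^bsub>K\<^esub> m X (Unt C) \<bullet>\<^bsub>K\<^esub> (Ide K (FO G X) \<boxtimes>\<^bsub>K\<^esub> m0) = Run K (FO G X)"

text \<open>In a non-strict category \<open>X\<^sup>\<otimes>\<^sup>n\<close> denotes the left-bracketed power, with
  \<open>X\<^sup>\<otimes>\<^sup>0 = I\<close> and \<open>X\<^sup>\<otimes>\<^sup>1 = X\<close>.\<close>

fun tpow :: "('o, 'a, 'x) mcat_scheme \<Rightarrow> 'o \<Rightarrow> nat \<Rightarrow> 'o" where
  "tpow C X 0 = Unt C"
| "tpow C X (Suc 0) = X"
| "tpow C X (Suc (Suc n)) = tpow C X (Suc n) \<otimes>\<^bsub>C\<^esub> X"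

text \<open>The \<open>n\<close>-ary structure isomorphism \<open>(G X)\<^sup>\<otimes>\<^sup>n \<cong> G (X\<^sup>\<otimes>\<^sup>n)\<close> generated by \<open>m\<close> and \<open>m0\<close>.\<close>

fun mpow :: "('o, 'a, 'x) mcat_scheme \<Rightarrow> ('p, 'b, 'y) mcat_scheme \<Rightarrow> ('o, 'a, 'p, 'b) fctr
    \<Rightarrow> ('o \<Rightarrow> 'o \<Rightarrow> 'b) \<Rightarrow> 'b \<Rightarrow> 'o \<Rightarrow> nat \<Rightarrow> 'b" where
  "mpow C K G m m0 X 0 = m0"
| "mpow C K G m m0 X (Suc 0) = Ide K (FO G X)"
| "mpow C K G m m0 X (Suc (Suc n)) =
     m (tpow C X (Suc n)) X \<bullet>\<^bsub>K\<^esub> (mpow C K G m m0 X (Suc n) \<boxtimes>\<^bsub>K\<^esub> Ide K (FO G X))"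

definition monoidal_structure_splits where
  "monoidal_structure_splits C D lam lam0 U1 lam1 lam01 U2 lam2 lam02 \<longleftrightarrow>
     (\<forall>X \<in> Obj C. \<forall>Y \<in> Obj C.
        lam X Y = FA U2 (lam1 X Y) \<bullet>\<^bsub>D\<^esub> lam2 (FO U1 X) (FO U1 Y)) \<and>
     lam0 = FA U2 lam01 \<bullet>\<^bsub>D\<^esub> lam02"


section \<open>Dual equivalences\<close>

text \<open>\<open>Dl\<close> and \<open>Dr\<close> are the two contravariant functors between a category and its dual;
  \<open>kap X : X \<rightarrow> Dr (Dl X)\<close> and \<open>kap' Y : Y \<rightarrow> Dl (Dr Y)\<close> are the isomorphisms along which
  double duals are identified with the original objects. The triangle identities of an adjoint
  equivalence are not required.\<close>

record ('o, 'a, 'p, 'b) dual_eq =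
  Dl :: "('o, 'a, 'p, 'b) fctr"
  Dr :: "('p, 'b, 'o, 'a) fctr"
  kap :: "'o \<Rightarrow> 'a"
  kap' :: "'p \<Rightarrow> 'b"

locale dual_equivalence =
  to_dual: is_functor "op_cat C" K "Dl d" + from_dual: is_functor "op_cat K" C "Dr d" +
  unit: nat_iso C C fid "Dr d \<cdot>\<^sub>F Dl d" "kap d" +
  counit: nat_iso K K fid "Dl d \<cdot>\<^sub>F Dr d" "kap' d"
  for C :: "('o, 'a, 'x) cat_scheme" and K :: "('p, 'b, 'y) cat_scheme"
    and d :: "('o, 'a, 'p, 'b, 'z) dual_eq_scheme"

text \<open>A dual category carrying the dual tensor: the duality is strong monoidal as a functor on
  the opposite category, with \<open>dm X Y\<close> from \<open>Dl X \<otimes> Dl Y\<close> to \<open>Dl (X \<otimes> Y)\<close>. This covers the tensor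
  \<open>X \<otimes> Y = Dl (Dr X \<otimes> Dr Y)\<close> as well as any isomorphic presentation of it.\<close>

record ('o, 'a, 'p, 'b) mdual_eq = "('o, 'a, 'p, 'b) dual_eq" +
  dm :: "'o \<Rightarrow> 'o \<Rightarrow> 'b"
  dm0 :: 'b

locale monoidal_dual_equivalence =
  dual_equivalence C K d + monoidal: strong_monoidal_functor "op_mcat C" K "Dl d" "dm d" "dm0 d"
  for C :: "('o, 'a, 'x) mcat_scheme" and K :: "('p, 'b, 'y) mcat_scheme"
    and d :: "('o, 'a, 'p, 'b, 'z) mdual_eq_scheme"

text \<open>The dual of a functor \<open>G : X \<rightarrow> Y\<close>; \<open>dX\<close> and \<open>dY\<close> are the dual equivalences of \<open>X\<close> and \<open>Y\<close>.\<close>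

definition dual_functor ::
  "('o, 'a, 'p, 'b, 'z) dual_eq_scheme \<Rightarrow> ('q, 'c, 'r, 'e, 'w) dual_eq_scheme
    \<Rightarrow> ('o, 'a, 'q, 'c) fctr \<Rightarrow> ('p, 'b, 'r, 'e) fctr" where
  "dual_functor dX dY G = Dl dY \<cdot>\<^sub>F G \<cdot>\<^sub>F Dr dX"

text \<open>The dual of a natural transformation from \<open>G\<close> to \<open>H\<close> goes from the dual of \<open>H\<close> to the dual
  of \<open>G\<close>.\<close>

definition dual_nat ::
  "('o, 'a, 'p, 'b, 'z) dual_eq_scheme \<Rightarrow> ('q, 'c, 'r, 'e, 'w) dual_eq_scheme
    \<Rightarrow> ('o \<Rightarrow> 'c) \<Rightarrow> 'p \<Rightarrow> 'e" where
  "dual_nat dX dY t W = FA (Dl dY) (t (FO (Dr dX) W))"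

text \<open>Dualization preserves composition, and commutes with application of functors to objects,
  only up to the identification of double duals. The first isomorphism goes from the composite of
  the duals of \<open>H : Y \<rightarrow> Z\<close> and \<open>G : X \<rightarrow> Y\<close> to the dual of \<open>H \<cdot>\<^sub>F G\<close>, at the object \<open>W\<close>; the second
  from the dual of \<open>G : X \<rightarrow> Y\<close>, applied to the dual of \<open>A\<close>, to the dual of \<open>G A\<close>.\<close>

definition dual_fcomp ::
  "('o, 'a, 'p, 'b, 'z) dual_eq_scheme \<Rightarrow> ('q, 'c, 'r, 'e, 'w) dual_eq_scheme
    \<Rightarrow> ('s, 'f, 't, 'g, 'v) dual_eq_scheme
    \<Rightarrow> ('q, 'c, 's, 'f) fctr \<Rightarrow> ('o, 'a, 'q, 'c) fctr \<Rightarrow> 'p \<Rightarrow> 'g" where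
  "dual_fcomp dX dY dZ H G W = FA (Dl dZ) (FA H (kap dY (FO G (FO (Dr dX) W))))"

definition dual_app ::
  "('o, 'a, 'p, 'b, 'z) dual_eq_scheme \<Rightarrow> ('q, 'c, 'r, 'e, 'w) dual_eq_scheme
    \<Rightarrow> ('o, 'a, 'q, 'c) fctr \<Rightarrow> 'o \<Rightarrow> 'e" where
  "dual_app dX dY G A = FA (Dl dY) (FA G (kap dX A))"


section \<open>The monad dual to a comonad, and the dual of a morphism\<close>

text \<open>The functor part of the monad dual to the comonad \<open>F \<cdot>\<^sub>F U\<close>; with \<open>F1\<close>, \<open>U1\<close> and the dual of
  the intermediate category in place of \<open>F\<close>, \<open>U\<close>, \<open>dD\<close> it is \<open>T\<^sub>1\<close>.\<close>

definition dual_monad ::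
  "('o, 'a, 'p, 'b, 'z) dual_eq_scheme \<Rightarrow> ('q, 'c, 'r, 'e, 'w) dual_eq_scheme
    \<Rightarrow> ('q, 'c, 'o, 'a) fctr \<Rightarrow> ('o, 'a, 'q, 'c) fctr \<Rightarrow> ('p, 'b, 'p, 'b) fctr" where
  "dual_monad dC dD F U = dual_functor dD dC F \<cdot>\<^sub>F dual_functor dC dD U"

text \<open>The dual of the counit of \<open>F : D \<rightarrow> E\<close> and \<open>U : E \<rightarrow> D\<close>, at an object \<open>Z\<close> of the dual \<open>Eh\<close> of
  \<open>E\<close>: from \<open>Z\<close> via the dual of the identity functor and the dual of \<open>F \<cdot>\<^sub>F U\<close> to the composite of
  the dual functors.\<close>

definition dual_counit ::
  "('p, 'b, 'y) cat_scheme \<Rightarrow> ('o, 'a, 'p, 'b, 'z) dual_eq_scheme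
    \<Rightarrow> ('q, 'c, 'r, 'e, 'w) dual_eq_scheme
    \<Rightarrow> ('q, 'c, 'o, 'a) fctr \<Rightarrow> ('o, 'a, 'q, 'c) fctr \<Rightarrow> ('o \<Rightarrow> 'a) \<Rightarrow> 'p \<Rightarrow> 'b" where
  "dual_counit Eh dE dD F U eps Z =
     inv_arr Eh (dual_fcomp dE dD dE F U Z) \<bullet>\<^bsub>Eh\<^esub> dual_nat dE dE eps Z \<bullet>\<^bsub>Eh\<^esub> kap' dE Z"

text \<open>The component at \<open>Y\<close> of the monad morphism \<open>T\<^sub>1 \<rightarrow> T\<close>: the dual of the counit \<open>eps2\<close> whiskered
  with the duals of \<open>F1\<close> and \<open>U1\<close>, followed by the identifications of composites of duals with
  duals of composites. Only its components enter the factorization condition, so the monad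
  structures are not formalized; compatibility with them needs coherent (adjoint) dualities.\<close>

definition monad_morphism_T1_T ::
  "('o, 'a, 'x) cat_scheme \<Rightarrow> ('p, 'b, 'y) cat_scheme
    \<Rightarrow> ('oc, 'ac, 'o, 'a, 'z) dual_eq_scheme \<Rightarrow> ('od, 'ad, 'q, 'c, 'w) dual_eq_scheme
    \<Rightarrow> ('oe, 'ae, 'p, 'b, 'v) dual_eq_scheme
    \<Rightarrow> ('oe, 'ae, 'oc, 'ac) fctr \<Rightarrow> ('oc, 'ac, 'oe, 'ae) fctr
    \<Rightarrow> ('od, 'ad, 'oe, 'ae) fctr \<Rightarrow> ('oe, 'ae, 'od, 'ad) fctr
    \<Rightarrow> ('oe \<Rightarrow> 'ae) \<Rightarrow> 'o \<Rightarrow> 'a" where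
  "monad_morphism_T1_T Ch Eh dC dD dE F1 U1 F2 U2 eps2 Y =
     FA (dual_functor dD dC (F1 \<cdot>\<^sub>F F2)) (dual_fcomp dC dE dD U2 U1 Y)
     \<bullet>\<^bsub>Ch\<^esub> dual_fcomp dD dE dC F1 F2
            (FO (dual_functor dE dD U2) (FO (dual_functor dC dE U1) Y))
     \<bullet>\<^bsub>Ch\<^esub> FA (dual_functor dE dC F1)
            (dual_counit Eh dE dD F2 U2 eps2 (FO (dual_functor dC dE U1) Y))"

text \<open>The dual of \<open>a : (U A)\<^sup>\<otimes>\<^sup>k \<rightarrow> (U B)\<^sup>\<otimes>\<^sup>n\<close>, from the \<open>n\<close>-th dual tensor power of the dual of \<open>B\<close> to
  \<open>T\<close> of the \<open>k\<close>-th dual tensor power of the dual of \<open>A\<close>. It is the dual of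
  \<open>h\<^sup>+ : F (U (A\<^sup>\<otimes>\<^sup>k)) \<rightarrow> B\<^sup>\<otimes>\<^sup>n\<close>, composed with the canonical isomorphisms.\<close>

definition monoidal_conjugate ::
  "('oc, 'ac, 'x) mcat_scheme \<Rightarrow> ('od, 'ad, 'y) mcat_scheme \<Rightarrow> ('oc, 'ac, 'od, 'ad) fctr
    \<Rightarrow> ('oc \<Rightarrow> 'oc \<Rightarrow> 'ad) \<Rightarrow> 'ad \<Rightarrow> 'oc \<Rightarrow> nat \<Rightarrow> 'oc \<Rightarrow> nat \<Rightarrow> 'ad \<Rightarrow> 'ad" where
  "monoidal_conjugate C D U lam lam0 A k B n a =
     mpow C D U lam lam0 B n \<bullet>\<^bsub>D\<^esub> a \<bullet>\<^bsub>D\<^esub> inv_arr D (mpow C D U lam lam0 A k)"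

definition dual_morphism ::
  "('oc, 'ac, 'x) mcat_scheme \<Rightarrow> ('od, 'ad, 'y) mcat_scheme \<Rightarrow> ('o, 'a, 'u) mcat_scheme
    \<Rightarrow> ('oc, 'ac, 'o, 'a, 'z) mdual_eq_scheme \<Rightarrow> ('od, 'ad, 'q, 'c, 'w) dual_eq_scheme
    \<Rightarrow> ('od, 'ad, 'oc, 'ac) fctr \<Rightarrow> ('oc, 'ac, 'od, 'ad) fctr \<Rightarrow> ('oc \<Rightarrow> 'ac)
    \<Rightarrow> ('oc \<Rightarrow> 'oc \<Rightarrow> 'ad) \<Rightarrow> 'ad \<Rightarrow> 'oc \<Rightarrow> nat \<Rightarrow> 'oc \<Rightarrow> nat \<Rightarrow> 'ad \<Rightarrow> 'a" where
  "dual_morphism C D Ch dC dD F U eps lam lam0 A k B n a =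
     FA (dual_monad dC dD F U) (inv_arr Ch (mpow (op_mcat C) Ch (Dl dC) (dm dC) (dm0 dC) A k))
     \<bullet>\<^bsub>Ch\<^esub> inv_arr Ch (dual_fcomp dC dD dC F U (FO (Dl dC) (tpow C A k)))
     \<bullet>\<^bsub>Ch\<^esub> inv_arr Ch (dual_app dC dC (F \<cdot>\<^sub>F U) (tpow C A k))
     \<bullet>\<^bsub>Ch\<^esub> FA (Dl dC)
          (transpose C F eps (tpow C B n) (monoidal_conjugate C D U lam lam0 A k B n a))
     \<bullet>\<^bsub>Ch\<^esub> mpow (op_mcat C) Ch (Dl dC) (dm dC) (dm0 dC) B n"

end

(* For X = A^k and Y = B^n, a lifts along U_2 iff h : U X -> U Y is U_2 b for some b, because
   lambda = U_2 lambda_1 . lambda_2 U_1. Transposing first under F_2 -| U_2 and then under F_1 -| U_1,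
   h = U_2 b becomes h^+ = g . F_1 eps_2 U_1 with g the transpose of b. The duality is fully
   faithful and turns this factorization into one of rho through the monad morphism; the double-dual
   isomorphisms only contribute invertible factors, moved aside by naturality. *)
theory Submission
  imports Defs
begin

section \<open>Categories, isomorphisms and functors\<close>

text \<open>The two isomorphism families of a dual equivalence, \<open>kap\<close> and
  \<open>kap'\<close>, are natural but not tied by triangle identities. The double-dual factors of
  \<open>rho\<close> and of the monad morphism therefore need not collapse, and they cannot be
  matched by coherence. Their position is used instead. Written as duals of arrows of
  \<open>C\<close>, the monad morphism and the part of \<open>rho\<close> after its structure
  isomorphism at \<open>B\<close> both start with one and the same isomorphism
  \<open>F1 F2 v\<close>, which cancels whatever it is. The other isomorphism in the monad morphism,
  \<open>F1 u\<close>, stands next to the unknown factor and is absorbed into it. The final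
  comparison thus needs the invertibility of these factors, not a formula for them. Getting both
  arrows into this shape is the task of the two computations on the dual monad.\<close>

lemma Hom_iff: "f \<in> Hom C X Y \<longleftrightarrow> f \<in> Arr C \<and> Src C f = X \<and> Tgt C f = Y"
  by (simp add: Hom_def)

context category
begin

lemmas [simp] = src_obj tgt_obj

lemma ide_arr [simp]:
  assumes "X \<in> Obj C"
  shows "Ide C X \<in> Arr C" "Src C (Ide C X) = X" "Tgt C (Ide C X) = X"
  using ide_hom[OF assms] by (auto simp: Hom_iff)

lemma cmp_arr [simp]:
  assumes "f \<in> Arr C" "g \<in> Arr C" "Src C g = Tgt C f"
  shows "g \<bullet>\<^bsub>C\<^esub> f \<in> Arr C" "Src C (g \<bullet>\<^bsub>C\<^esub> f) = Src C f" "Tgt C (g \<bullet>\<^bsub>C\<^esub> f) = Tgt C g"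
  using cmp_hom[of f "Src C f" "Tgt C f" g "Tgt C g"] assms by (auto simp: Hom_iff)

lemma cmp_ide [simp]:
  assumes "f \<in> Arr C"
  shows "Tgt C f = Y \<Longrightarrow> Ide C Y \<bullet>\<^bsub>C\<^esub> f = f" "Src C f = X \<Longrightarrow> f \<bullet>\<^bsub>C\<^esub> Ide C X = f"
  using ide_left ide_right assms by (auto simp: Hom_iff)

lemma assoc [simp]:
  assumes "f \<in> Arr C" "g \<in> Arr C" "h \<in> Arr C" "Src C g = Tgt C f" "Src C h = Tgt C g"
  shows "(h \<bullet>\<^bsub>C\<^esub> g) \<bullet>\<^bsub>C\<^esub> f = h \<bullet>\<^bsub>C\<^esub> (g \<bullet>\<^bsub>C\<^esub> f)"
  using cmp_assoc[of f "Src C f" "Tgt C f" g "Tgt C g" h "Tgt C h"] assms by (auto simp: Hom_iff)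

lemma inverse_arrows_unique:
  assumes "inverse_arrows C f g" "inverse_arrows C f g'"
  shows "g = g'"
proof -
  have "g = g \<bullet>\<^bsub>C\<^esub> (f \<bullet>\<^bsub>C\<^esub> g')"
    using assms by (simp add: inverse_arrows_def Hom_iff)
  also have "\<dots> = (g \<bullet>\<^bsub>C\<^esub> f) \<bullet>\<^bsub>C\<^esub> g'"
    by (rule assoc[symmetric]) (use assms in \<open>simp_all add: inverse_arrows_def Hom_iff\<close>)
  also have "\<dots> = g'"
    using assms by (simp add: inverse_arrows_def Hom_iff)
  finally show ?thesis .
qed

lemma inv_arr_eq: "inverse_arrows C f g \<Longrightarrow> inv_arr C f = g"
  unfolding inv_arr_def using inverse_arrows_unique by blast

lemma inverse_arrows_inv_arr: "is_iso C f \<Longrightarrow> inverse_arrows C f (inv_arr C f)"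
  using inv_arr_eq by (auto simp: is_iso_def)

lemma iso_arr: "is_iso C f \<Longrightarrow> f \<in> Arr C"
  by (auto simp: is_iso_def inverse_arrows_def)

lemma inv_arr_simps [simp]:
  assumes "is_iso C f"
  shows "inv_arr C f \<in> Arr C" "Src C (inv_arr C f) = Tgt C f" "Tgt C (inv_arr C f) = Src C f"
    "inv_arr C f \<bullet>\<^bsub>C\<^esub> f = Ide C (Src C f)" "f \<bullet>\<^bsub>C\<^esub> inv_arr C f = Ide C (Tgt C f)"
  using inverse_arrows_inv_arr[OF assms] by (auto simp: inverse_arrows_def Hom_iff)

text \<open>In a right-bracketed composite, an arrow and its inverse can be adjacent without forming
  a composite of their own; hence the trailing arrow \<open>g\<close>.\<close>

lemma inv_arr_cancel [simp]:
  assumes "is_iso C f" "g \<in> Arr C"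
  shows "Tgt C g = Src C f \<Longrightarrow> inv_arr C f \<bullet>\<^bsub>C\<^esub> (f \<bullet>\<^bsub>C\<^esub> g) = g"
    "Tgt C g = Tgt C f \<Longrightarrow> f \<bullet>\<^bsub>C\<^esub> (inv_arr C f \<bullet>\<^bsub>C\<^esub> g) = g"
proof -
  note [simp] = iso_arr[OF assms(1)] assms
  show "inv_arr C f \<bullet>\<^bsub>C\<^esub> (f \<bullet>\<^bsub>C\<^esub> g) = g" if "Tgt C g = Src C f"
    using that assoc[of g f "inv_arr C f"] by simp
  show "f \<bullet>\<^bsub>C\<^esub> (inv_arr C f \<bullet>\<^bsub>C\<^esub> g) = g" if "Tgt C g = Tgt C f"
    using that assoc[of g "inv_arr C f" f] by simp
qed

lemma iso_ide: "X \<in> Obj C \<Longrightarrow> is_iso C (Ide C X)"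
  by (auto simp: is_iso_def inverse_arrows_def Hom_iff intro!: exI[of _ "Ide C X"])

lemma iso_inv_arr: "is_iso C f \<Longrightarrow> is_iso C (inv_arr C f)"
  by (auto simp: is_iso_def[of C "inv_arr C f"] inverse_arrows_def Hom_iff iso_arr intro!: exI[of _ f])

lemma iso_cmp:
  assumes "is_iso C f" "is_iso C g" "Src C g = Tgt C f"
  shows "is_iso C (g \<bullet>\<^bsub>C\<^esub> f)"
proof -
  note [simp] = assms iso_arr
  have "inverse_arrows C (g \<bullet>\<^bsub>C\<^esub> f) (inv_arr C f \<bullet>\<^bsub>C\<^esub> inv_arr C g)"
    by (simp add: inverse_arrows_def Hom_iff)
  then show ?thesis
    by (auto simp: is_iso_def)
qed

lemma iso_cancel_left:
  assumes "is_iso C f" "g \<in> Arr C" "h \<in> Arr C" "Tgt C g = Src C f" "Tgt C h = Src C f"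
    "f \<bullet>\<^bsub>C\<^esub> g = f \<bullet>\<^bsub>C\<^esub> h"
  shows "g = h"
  using inv_arr_cancel(1)[OF assms(1,2,4)] inv_arr_cancel(1)[OF assms(1,3,5)] assms(6) by metis

lemma iso_cancel_right:
  assumes "is_iso C f" "g \<in> Arr C" "h \<in> Arr C" "Src C g = Tgt C f" "Src C h = Tgt C f"
    "g \<bullet>\<^bsub>C\<^esub> f = h \<bullet>\<^bsub>C\<^esub> f"
  shows "g = h"
proof -
  note [simp] = assms(1-5) iso_arr
  have "(g \<bullet>\<^bsub>C\<^esub> f) \<bullet>\<^bsub>C\<^esub> inv_arr C f = (h \<bullet>\<^bsub>C\<^esub> f) \<bullet>\<^bsub>C\<^esub> inv_arr C f"
    by (simp only: assms(6))
  then show ?thesis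
    by simp
qed

text \<open>The isomorphism \<open>q\<close> occurs on both sides and cancels; \<open>u\<close>
  stands next to the unknown factor, so \<open>s\<close> and \<open>g = s u\<close> determine each
  other.\<close>

lemma factors_iff_cancel_iso:
  assumes f: "f \<in> Hom C X Y" and e: "e \<in> Hom C X Z"
    and q: "is_iso C q" "q \<in> Hom C W X" and u: "is_iso C u" "u \<in> Hom C Z Z'"
  shows "(\<exists>s \<in> Hom C Z' Y. f \<bullet>\<^bsub>C\<^esub> q = s \<bullet>\<^bsub>C\<^esub> u \<bullet>\<^bsub>C\<^esub> e \<bullet>\<^bsub>C\<^esub> q) \<longleftrightarrow> (\<exists>g \<in> Hom C Z Y. f = g \<bullet>\<^bsub>C\<^esub> e)"
proof -
  have [simp]: "f \<in> Arr C" "Src C f = X" "Tgt C f = Y" "e \<in> Arr C" "Src C e = X" "Tgt C e = Z"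
    "q \<in> Arr C" "Src C q = W" "Tgt C q = X" "u \<in> Arr C" "Src C u = Z" "Tgt C u = Z'"
    using f e q u by (auto simp: Hom_iff)
  note [simp] = q(1) u(1)
  show ?thesis
  proof safe
    fix s assume s: "s \<in> Hom C Z' Y" and eq: "f \<bullet>\<^bsub>C\<^esub> q = s \<bullet>\<^bsub>C\<^esub> u \<bullet>\<^bsub>C\<^esub> e \<bullet>\<^bsub>C\<^esub> q"
    have [simp]: "s \<in> Arr C" "Src C s = Z'" "Tgt C s = Y"
      using s by (auto simp: Hom_iff)
    have "f = (s \<bullet>\<^bsub>C\<^esub> u) \<bullet>\<^bsub>C\<^esub> e"
      by (rule iso_cancel_right[of q]) (simp_all add: eq)
    then show "\<exists>g \<in> Hom C Z Y. f = g \<bullet>\<^bsub>C\<^esub> e"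
      by (rule bexI) (simp add: Hom_iff)
  next
    fix g assume g: "g \<in> Hom C Z Y" and eq: "f = g \<bullet>\<^bsub>C\<^esub> e"
    have [simp]: "g \<in> Arr C" "Src C g = Z" "Tgt C g = Y"
      using g by (auto simp: Hom_iff)
    show "\<exists>s \<in> Hom C Z' Y. (g \<bullet>\<^bsub>C\<^esub> e) \<bullet>\<^bsub>C\<^esub> q = s \<bullet>\<^bsub>C\<^esub> u \<bullet>\<^bsub>C\<^esub> e \<bullet>\<^bsub>C\<^esub> q"
      by (rule bexI[of _ "g \<bullet>\<^bsub>C\<^esub> inv_arr C u"]) (simp_all add: Hom_iff)
  qed
qed

end

section \<open>Opposite categories\<close>

lemma op_cat_simps [simp]:
  "Obj (op_cat C) = Obj C" "Arr (op_cat C) = Arr C" "Src (op_cat C) = Tgt C"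
  "Tgt (op_cat C) = Src C" "Ide (op_cat C) = Ide C" "Cmp (op_cat C) g f = f \<bullet>\<^bsub>C\<^esub> g"
  by (simp_all add: op_cat_def)

text \<open>Reversal swaps source with target and the two inverse equations with each other, so the
  roles of \<open>f\<close> and \<open>g\<close> stay as they are.\<close>

lemma inverse_arrows_op: "inverse_arrows (op_cat C) f g \<longleftrightarrow> inverse_arrows C f g"
  by (auto simp: inverse_arrows_def Hom_iff)

lemma is_iso_op [simp]: "is_iso (op_cat C) f \<longleftrightarrow> is_iso C f"
  by (simp add: is_iso_def inverse_arrows_op)

lemma inv_arr_op [simp]: "inv_arr (op_cat C) f = inv_arr C f"
  by (simp add: inv_arr_def inverse_arrows_op)

lemma op_mcat_simps [simp]:
  "Obj (op_mcat C) = Obj C" "Arr (op_mcat C) = Arr C" "Src (op_mcat C) = Tgt C"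
  "Tgt (op_mcat C) = Src C" "Ide (op_mcat C) = Ide C" "Unt (op_mcat C) = Unt C"
  "TenO (op_mcat C) = TenO C"
  by (simp_all add: op_mcat_def op_cat_def)

lemma tpow_op [simp]: "tpow (op_mcat C) X n = tpow C X n"
  by (induction n rule: induct_nat_012) simp_all

lemma fctr_simps [simp]:
  "FO fid X = X" "FA fid f = f"
  "FO (H \<cdot>\<^sub>F G) X = FO H (FO G X)" "FA (H \<cdot>\<^sub>F G) f = FA H (FA G f)"
  by (simp_all add: fid_def fcomp_def)

section \<open>Functors acting on isomorphisms and on conjugated arrows\<close>

context is_functor
begin

lemmas [simp] = fobj fide

lemma arr [simp]:
  assumes "f \<in> Arr C"
  shows "FA G f \<in> Arr K" "Src K (FA G f) = FO G (Src C f)" "Tgt K (FA G f) = FO G (Tgt C f)"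
  using fhom[of f "Src C f" "Tgt C f"] assms by (auto simp: Hom_iff)

lemma cmp:
  assumes "f \<in> Arr C" "g \<in> Arr C" "Src C g = Tgt C f"
  shows "FA G (g \<bullet>\<^bsub>C\<^esub> f) = FA G g \<bullet>\<^bsub>K\<^esub> FA G f"
  using fcmp[of f "Src C f" "Tgt C f" g "Tgt C g"] assms by (auto simp: Hom_iff)

lemma inverse_arrows_map:
  assumes "inverse_arrows C f g"
  shows "inverse_arrows K (FA G f) (FA G g)"
proof -
  have [simp]: "f \<in> Arr C" "g \<in> Arr C" "Src C g = Tgt C f" "Tgt C g = Src C f"
    "g \<bullet>\<^bsub>C\<^esub> f = Ide C (Src C f)" "f \<bullet>\<^bsub>C\<^esub> g = Ide C (Tgt C f)"
    using assms by (auto simp: inverse_arrows_def Hom_iff)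
  show ?thesis
    using cmp[of f g] cmp[of g f] by (simp add: inverse_arrows_def Hom_iff)
qed

lemma iso_map: "is_iso C f \<Longrightarrow> is_iso K (FA G f)"
  using inverse_arrows_map by (auto simp: is_iso_def)

lemma inv_arr_map: "is_iso C f \<Longrightarrow> inv_arr K (FA G f) = FA G (inv_arr C f)"
  by (intro target.inv_arr_eq inverse_arrows_map source.inverse_arrows_inv_arr)

text \<open>The \<open>q\<close> factors are cancelled by the conjugation, while the
  \<open>p\<close> factors lie in the image of \<open>G\<close> and merely change the lift
  \<open>b\<close> to its conjugate in \<open>C\<close>. With \<open>G = U2\<close> this passes from
  lifts of \<open>a\<close> to lifts of \<open>h\<close>.\<close>

lemma lifts_iff_conjugate_lifts:
  assumes p: "is_iso C pX" "pX \<in> Hom C X X'" "is_iso C pY" "pY \<in> Hom C Y Y'"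
    and q: "is_iso K qX" "qX \<in> Hom K V (FO G X)" "is_iso K qY" "qY \<in> Hom K W (FO G Y)"
    and a: "a \<in> Hom K V W"
  shows "(\<exists>b \<in> Hom C X Y. a = inv_arr K qY \<bullet>\<^bsub>K\<^esub> FA G b \<bullet>\<^bsub>K\<^esub> qX) \<longleftrightarrow>
    (\<exists>b \<in> Hom C X' Y'. (FA G pY \<bullet>\<^bsub>K\<^esub> qY) \<bullet>\<^bsub>K\<^esub> a \<bullet>\<^bsub>K\<^esub> inv_arr K (FA G pX \<bullet>\<^bsub>K\<^esub> qX) = FA G b)"
proof -
  have [simp]: "pX \<in> Arr C" "Src C pX = X" "Tgt C pX = X'" "pY \<in> Arr C" "Src C pY = Y" "Tgt C pY = Y'"
    "qX \<in> Arr K" "Src K qX = V" "Tgt K qX = FO G X" "qY \<in> Arr K" "Src K qY = W" "Tgt K qY = FO G Y"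
    "a \<in> Arr K" "Src K a = V" "Tgt K a = W"
    using p q a by (auto simp: Hom_iff)
  note [simp] = p(1,3) q(1,3) iso_map
  define r where "r = FA G pX \<bullet>\<^bsub>K\<^esub> qX"
  have [simp]: "is_iso K r" "r \<in> Arr K" "Src K r = V" "Tgt K r = FO G X'"
    by (simp_all add: r_def target.iso_cmp)
  show ?thesis
    unfolding r_def[symmetric]
  proof safe
    fix b assume b: "b \<in> Hom C X Y"
    then have [simp]: "b \<in> Arr C" "Src C b = X" "Tgt C b = Y"
      by (auto simp: Hom_iff)
    \<comment> \<open>Writing \<open>qX\<close> as the inverse of \<open>FA G pX\<close> after
      \<open>r\<close> lets \<open>r\<close> cancel, leaving an arrow in the image of
      \<open>G\<close>.\<close>
    have "qX \<bullet>\<^bsub>K\<^esub> inv_arr K r = (inv_arr K (FA G pX) \<bullet>\<^bsub>K\<^esub> r) \<bullet>\<^bsub>K\<^esub> inv_arr K r"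
      by (simp add: r_def del: target.assoc)
    then have "qX \<bullet>\<^bsub>K\<^esub> inv_arr K r = FA G (inv_arr C pX)"
      by (simp add: inv_arr_map)
    then have "(FA G pY \<bullet>\<^bsub>K\<^esub> qY) \<bullet>\<^bsub>K\<^esub> (inv_arr K qY \<bullet>\<^bsub>K\<^esub> FA G b \<bullet>\<^bsub>K\<^esub> qX) \<bullet>\<^bsub>K\<^esub> inv_arr K r
        = FA G (pY \<bullet>\<^bsub>C\<^esub> b \<bullet>\<^bsub>C\<^esub> inv_arr C pX)"
      by (simp add: cmp)
    then show "\<exists>c \<in> Hom C X' Y'. (FA G pY \<bullet>\<^bsub>K\<^esub> qY) \<bullet>\<^bsub>K\<^esub>
        (inv_arr K qY \<bullet>\<^bsub>K\<^esub> FA G b \<bullet>\<^bsub>K\<^esub> qX) \<bullet>\<^bsub>K\<^esub> inv_arr K r = FA G c"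
      by (intro bexI[of _ "pY \<bullet>\<^bsub>C\<^esub> b \<bullet>\<^bsub>C\<^esub> inv_arr C pX"]) (simp_all add: Hom_iff)
  next
    fix b assume b: "b \<in> Hom C X' Y'"
      and eq: "(FA G pY \<bullet>\<^bsub>K\<^esub> qY) \<bullet>\<^bsub>K\<^esub> a \<bullet>\<^bsub>K\<^esub> inv_arr K r = FA G b"
    have [simp]: "b \<in> Arr C" "Src C b = X'" "Tgt C b = Y'"
      using b by (auto simp: Hom_iff)
    \<comment> \<open>The inverse conjugation, carried out in \<open>C\<close>, where the witness
      has to live.\<close>
    let ?b = "inv_arr C pY \<bullet>\<^bsub>C\<^esub> b \<bullet>\<^bsub>C\<^esub> pX"
    have "a = inv_arr K qY \<bullet>\<^bsub>K\<^esub> inv_arr K (FA G pY)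
        \<bullet>\<^bsub>K\<^esub> ((FA G pY \<bullet>\<^bsub>K\<^esub> qY) \<bullet>\<^bsub>K\<^esub> a \<bullet>\<^bsub>K\<^esub> inv_arr K r) \<bullet>\<^bsub>K\<^esub> r"
      by simp
    also have "\<dots> = inv_arr K qY \<bullet>\<^bsub>K\<^esub> FA G ?b \<bullet>\<^bsub>K\<^esub> qX"
      unfolding eq by (simp add: r_def cmp inv_arr_map)
    finally show "\<exists>b \<in> Hom C X Y. a = inv_arr K qY \<bullet>\<^bsub>K\<^esub> FA G b \<bullet>\<^bsub>K\<^esub> qX"
      by (intro bexI[of _ ?b]) (simp_all add: Hom_iff)
  qed
qed

end

context nat_trans
begin

lemma component_arr [simp]:
  assumes "X \<in> Obj C"
  shows "t X \<in> Arr K" "Src K (t X) = FO G X" "Tgt K (t X) = FO H X"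
  using component[OF assms] by (auto simp: Hom_iff)

lemma natural: "f \<in> Arr C \<Longrightarrow> t (Tgt C f) \<bullet>\<^bsub>K\<^esub> FA G f = FA H f \<bullet>\<^bsub>K\<^esub> t (Src C f)"
  by (rule naturality) (simp add: Hom_iff)

end

section \<open>Adjoint transposes\<close>

context adjunction
begin

lemma transpose_arr:
  assumes "X \<in> Obj D" "Y \<in> Obj C" "h \<in> Hom D X (FO U Y)"
  shows "transpose C F eps Y h \<in> Hom C (FO F X) Y"
  using assms by (auto simp: transpose_def Hom_iff)

text \<open>An arrow is recovered from its transpose by applying \<open>U\<close> and precomposing
  with the unit: naturality of \<open>eta\<close> moves it past the unit, and a triangle identity
  removes the rest.\<close>

lemma transpose_inject:
  assumes X: "X \<in> Obj D" "Y \<in> Obj C" and h: "h \<in> Hom D X (FO U Y)" "h' \<in> Hom D X (FO U Y)"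
    and eq: "transpose C F eps Y h = transpose C F eps Y h'"
  shows "h = h'"
proof -
  have "FA U (transpose C F eps Y g) \<bullet>\<^bsub>D\<^esub> eta X = g" if "g \<in> Hom D X (FO U Y)" for g
  proof -
    have [simp]: "g \<in> Arr D" "Src D g = X" "Tgt D g = FO U Y" "X \<in> Obj D" "Y \<in> Obj C"
      using that X by (auto simp: Hom_iff)
    have "FA U (transpose C F eps Y g) \<bullet>\<^bsub>D\<^esub> eta X = FA U (eps Y) \<bullet>\<^bsub>D\<^esub> (FA U (FA F g) \<bullet>\<^bsub>D\<^esub> eta X)"
      by (simp add: transpose_def right.cmp)
    also have "\<dots> = FA U (eps Y) \<bullet>\<^bsub>D\<^esub> (eta (FO U Y) \<bullet>\<^bsub>D\<^esub> g)"
      using unit.natural[of g] by simp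
    also have "\<dots> = (FA U (eps Y) \<bullet>\<^bsub>D\<^esub> eta (FO U Y)) \<bullet>\<^bsub>D\<^esub> g"
      by (rule unit.domain.source.assoc[symmetric]) simp_all
    also have "\<dots> = g"
      by (simp add: triangle_right)
    finally show ?thesis .
  qed
  then show ?thesis
    using h eq by metis
qed

lemma transpose_surj:
  assumes X: "X \<in> Obj D" "Y \<in> Obj C" and g: "g \<in> Hom C (FO F X) Y"
  obtains h where "h \<in> Hom D X (FO U Y)" "transpose C F eps Y h = g"
proof
  have [simp]: "g \<in> Arr C" "Src C g = FO F X" "Tgt C g = Y" "X \<in> Obj D" "Y \<in> Obj C"
    using X g by (auto simp: Hom_iff)
  \<comment> \<open>The inverse transpose of \<open>g\<close>, built from the unit.\<close>
  show "FA U g \<bullet>\<^bsub>D\<^esub> eta X \<in> Hom D X (FO U Y)"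
    by (simp add: Hom_iff)
  have "transpose C F eps Y (FA U g \<bullet>\<^bsub>D\<^esub> eta X) = eps Y \<bullet>\<^bsub>C\<^esub> (FA F (FA U g) \<bullet>\<^bsub>C\<^esub> FA F (eta X))"
    by (simp add: transpose_def left.cmp)
  also have "\<dots> = (eps Y \<bullet>\<^bsub>C\<^esub> FA F (FA U g)) \<bullet>\<^bsub>C\<^esub> FA F (eta X)"
    by (rule counit.domain.source.assoc[symmetric]) simp_all
  also have "\<dots> = (g \<bullet>\<^bsub>C\<^esub> eps (FO F X)) \<bullet>\<^bsub>C\<^esub> FA F (eta X)"
    using counit.natural[of g] by simp
  also have "\<dots> = g"
    by (simp add: triangle_left)
  finally show "transpose C F eps Y (FA U g \<bullet>\<^bsub>D\<^esub> eta X) = g" .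
qed

lemma transpose_precomp:
  assumes "f \<in> Arr D" "h \<in> Arr D" "Src D h = Tgt D f" "Tgt D h = FO U Y" "Y \<in> Obj C"
  shows "transpose C F eps Y (h \<bullet>\<^bsub>D\<^esub> f) = transpose C F eps Y h \<bullet>\<^bsub>C\<^esub> FA F f"
  using assms by (simp add: transpose_def left.cmp)

text \<open>This is naturality of the counit. Under transposition, the image of \<open>U\<close>
  becomes the arrows that factor through a counit component.\<close>

lemma transpose_map:
  assumes "b \<in> Arr C"
  shows "transpose C F eps (Tgt C b) (FA U b) = b \<bullet>\<^bsub>C\<^esub> eps (Src C b)"
  using counit.natural[OF assms] by (simp add: transpose_def)

end

text \<open>Transposing under \<open>F2 -| U2\<close> turns \<open>FA U2 b\<close> into
  \<open>b\<close> after \<open>eps2\<close>; transposing under \<open>F1 -| U1\<close> turns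
  precomposition with \<open>eps2\<close> into precomposition with \<open>F1 eps2\<close>.
  Injectivity of both transpositions makes each passage reversible for a fixed
  \<open>b\<close>.\<close>

lemma lift_iff_transpose_factors:
  assumes "adjunction E C F1 U1 eta1 eps1" "adjunction D E F2 U2 eta2 eps2"
    and X: "X \<in> Obj C" and Y: "Y \<in> Obj C"
    and h: "h \<in> Hom D (FO U2 (FO U1 X)) (FO U2 (FO U1 Y))"
  shows "(\<exists>b \<in> Hom E (FO U1 X) (FO U1 Y). h = FA U2 b) \<longleftrightarrow>
    (\<exists>g \<in> Hom C (FO F1 (FO U1 X)) Y.
       transpose C F1 eps1 Y (transpose E F2 eps2 (FO U1 Y) h) = g \<bullet>\<^bsub>C\<^esub> FA F1 (eps2 (FO U1 X)))"
proof -
  interpret adj1: adjunction E C F1 U1 eta1 eps1 by fact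
  interpret adj2: adjunction D E F2 U2 eta2 eps2 by fact
  note [simp] = X Y
  have h2: "transpose E F2 eps2 (FO U1 Y) h \<in> Hom E (FO F2 (FO U2 (FO U1 X))) (FO U1 Y)"
    using h by (intro adj2.transpose_arr) auto
  have "h = FA U2 b \<longleftrightarrow>
      transpose C F1 eps1 Y (transpose E F2 eps2 (FO U1 Y) h)
        = transpose C F1 eps1 Y b \<bullet>\<^bsub>C\<^esub> FA F1 (eps2 (FO U1 X))"
    if b: "b \<in> Hom E (FO U1 X) (FO U1 Y)" for b
  proof -
    have [simp]: "b \<in> Arr E" "Src E b = FO U1 X" "Tgt E b = FO U1 Y"
      using b by (auto simp: Hom_iff)
    have "transpose E F2 eps2 (FO U1 Y) (FA U2 b) = b \<bullet>\<^bsub>E\<^esub> eps2 (FO U1 X)"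
      using adj2.transpose_map[of b] by simp
    then have "h = FA U2 b \<longleftrightarrow> transpose E F2 eps2 (FO U1 Y) h = b \<bullet>\<^bsub>E\<^esub> eps2 (FO U1 X)"
      using adj2.transpose_inject[OF _ _ h, of "FA U2 b"] by (auto simp: Hom_iff)
    also have "\<dots> \<longleftrightarrow> transpose C F1 eps1 Y (transpose E F2 eps2 (FO U1 Y) h)
        = transpose C F1 eps1 Y (b \<bullet>\<^bsub>E\<^esub> eps2 (FO U1 X))"
      using adj1.transpose_inject[OF _ _ h2, of "b \<bullet>\<^bsub>E\<^esub> eps2 (FO U1 X)"] by (auto simp: Hom_iff)
    also have "transpose C F1 eps1 Y (b \<bullet>\<^bsub>E\<^esub> eps2 (FO U1 X))
        = transpose C F1 eps1 Y b \<bullet>\<^bsub>C\<^esub> FA F1 (eps2 (FO U1 X))"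
      by (rule adj1.transpose_precomp) simp_all
    finally show ?thesis .
  qed
  \<comment> \<open>Transposition under \<open>F1 -| U1\<close> is onto, so letting \<open>b\<close>
    vary is the same as letting \<open>g\<close> vary.\<close>
  moreover have "\<exists>b \<in> Hom E (FO U1 X) (FO U1 Y). transpose C F1 eps1 Y b = g"
    if "g \<in> Hom C (FO F1 (FO U1 X)) Y" for g
    using adj1.transpose_surj[OF _ _ that] by auto
  moreover have "transpose C F1 eps1 Y b \<in> Hom C (FO F1 (FO U1 X)) Y"
    if "b \<in> Hom E (FO U1 X) (FO U1 Y)" for b
    using adj1.transpose_arr[OF _ _ that] by simp
  ultimately show ?thesis
    by blast
qed

section \<open>Iterated structure isomorphisms\<close>

context monoidal_category
begin

lemma tpow_obj [simp]: "X \<in> Obj C \<Longrightarrow> tpow C X n \<in> Obj C"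
  by (induction n rule: induct_nat_012) (auto intro: unt_obj ten_obj)

lemma ten_arr [simp]:
  assumes "f \<in> Arr C" "g \<in> Arr C"
  shows "f \<boxtimes>\<^bsub>C\<^esub> g \<in> Arr C" "Src C (f \<boxtimes>\<^bsub>C\<^esub> g) = Src C f \<otimes>\<^bsub>C\<^esub> Src C g"
    "Tgt C (f \<boxtimes>\<^bsub>C\<^esub> g) = Tgt C f \<otimes>\<^bsub>C\<^esub> Tgt C g"
  using ten_hom[of f "Src C f" "Tgt C f" g "Src C g" "Tgt C g"] assms by (auto simp: Hom_iff)

lemma interchange:
  assumes "f \<in> Arr C" "f' \<in> Arr C" "Src C f' = Tgt C f" "g \<in> Arr C" "g' \<in> Arr C" "Src C g' = Tgt C g"
  shows "(f' \<bullet>\<^bsub>C\<^esub> f) \<boxtimes>\<^bsub>C\<^esub> (g' \<bullet>\<^bsub>C\<^esub> g) = (f' \<boxtimes>\<^bsub>C\<^esub> g') \<bullet>\<^bsub>C\<^esub> (f \<boxtimes>\<^bsub>C\<^esub> g)"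
  by (rule ten_cmp) (use assms in \<open>auto simp: Hom_iff\<close>)

lemma ten_iso:
  assumes "is_iso C f" "is_iso C g"
  shows "is_iso C (f \<boxtimes>\<^bsub>C\<^esub> g)"
proof -
  note [simp] = assms iso_arr
  have "inverse_arrows C (f \<boxtimes>\<^bsub>C\<^esub> g) (inv_arr C f \<boxtimes>\<^bsub>C\<^esub> inv_arr C g)"
    by (simp add: inverse_arrows_def Hom_iff interchange[symmetric] ten_ide)
  then show ?thesis
    by (auto simp: is_iso_def)
qed

end

context strong_monoidal_functor
begin

lemma m_arr [simp]:
  assumes "X \<in> Obj C" "Y \<in> Obj C"
  shows "m X Y \<in> Arr K" "Src K (m X Y) = FO G X \<otimes>\<^bsub>K\<^esub> FO G Y"
    "Tgt K (m X Y) = FO G (X \<otimes>\<^bsub>C\<^esub> Y)"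
  using m_hom[OF assms] by (auto simp: Hom_iff)

text \<open>Invertibility and typing share one induction because composing isomorphisms requires
  matching ends. The case 1 is separate since the first power is the object itself, not its product
  with the unit.\<close>

lemma mpow_iso_hom:
  assumes "X \<in> Obj C"
  shows "is_iso K (mpow C K G m m0 X n)
    \<and> mpow C K G m m0 X n \<in> Hom K (tpow K (FO G X) n) (FO G (tpow C X n))"
proof (induction n rule: induct_nat_012)
  case 0
  then show ?case by (simp add: m0_iso m0_hom)
next
  case 1
  then show ?case using assms by (simp add: target.iso_ide Hom_iff)
next
  case (ge2 n)
  then show ?case
    using assms by (auto simp: Hom_iff intro!: target.iso_cmp target.ten_iso m_iso target.iso_ide)
qed

lemma mpow_iso [simp]: "X \<in> Obj C \<Longrightarrow> is_iso K (mpow C K G m m0 X n)"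
  using mpow_iso_hom by blast

lemma mpow_arr [simp]:
  assumes "X \<in> Obj C"
  shows "mpow C K G m m0 X n \<in> Arr K"
    "Src K (mpow C K G m m0 X n) = tpow K (FO G X) n"
    "Tgt K (mpow C K G m m0 X n) = FO G (tpow C X n)"
  using mpow_iso_hom[OF assms, of n] by (auto simp: Hom_iff)

end

text \<open>Naturality of \<open>lam2\<close> carries the binary splitting to all powers: the image
  under \<open>U2\<close> of the previous stage has to move past \<open>lam2\<close> to join the
  other images under \<open>U2\<close>.\<close>

lemma mpow_splits:
  assumes "strong_monoidal_functor C E U1 lam1 lam01" "strong_monoidal_functor E D U2 lam2 lam02"
    and splits: "monoidal_structure_splits C D lam lam0 U1 lam1 lam01 U2 lam2 lam02"
    and UX: "FO U X = FO U2 (FO U1 X)" and X: "X \<in> Obj C"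
  shows "mpow C D U lam lam0 X n
    = FA U2 (mpow C E U1 lam1 lam01 X n) \<bullet>\<^bsub>D\<^esub> mpow E D U2 lam2 lam02 (FO U1 X) n"
proof -
  interpret U1: strong_monoidal_functor C E U1 lam1 lam01 by fact
  interpret U2: strong_monoidal_functor E D U2 lam2 lam02 by fact
  note [simp] = X UX U1.m_iso U2.m_iso
  show ?thesis
  proof (induction n rule: induct_nat_012)
    case 0
    then show ?case using splits by (simp add: monoidal_structure_splits_def)
  next
    case 1
    then show ?case by simp
  next
    case (ge2 n)
    define P where "P = tpow C X (Suc n)"
    define p where "p = mpow C E U1 lam1 lam01 X (Suc n)"
    define q where "q = mpow E D U2 lam2 lam02 (FO U1 X) (Suc n)"
    define Q where "Q = tpow E (FO U1 X) (Suc n)"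
    have [simp]: "P \<in> Obj C" "Q \<in> Obj E" "p \<in> Arr E" "Src E p = Q" "Tgt E p = FO U1 P" "q \<in> Arr D"
      "Tgt D q = FO U2 Q" "P \<otimes>\<^bsub>C\<^esub> X \<in> Obj C"
      unfolding P_def p_def q_def Q_def by (simp_all del: tpow.simps mpow.simps add: U1.source.ten_obj)
    have lam: "lam P X = FA U2 (lam1 P X) \<bullet>\<^bsub>D\<^esub> lam2 (FO U1 P) (FO U1 X)"
      using splits by (simp add: monoidal_structure_splits_def)
    \<comment> \<open>The identity on the second factor is doubled so that interchange can separate
      \<open>FA U2 p\<close> from \<open>q\<close>.\<close>
    have "mpow C D U lam lam0 X (Suc (Suc n))
        = lam P X \<bullet>\<^bsub>D\<^esub> ((FA U2 p \<bullet>\<^bsub>D\<^esub> q) \<boxtimes>\<^bsub>D\<^esub> (Ide D (FO U2 (FO U1 X)) \<bullet>\<^bsub>D\<^esub> Ide D (FO U2 (FO U1 X))))"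
      using ge2(2) by (simp add: P_def p_def q_def del: tpow.simps(3))
    also have "\<dots> = FA U2 (lam1 P X) \<bullet>\<^bsub>D\<^esub> (lam2 (FO U1 P) (FO U1 X)
        \<bullet>\<^bsub>D\<^esub> ((FA U2 p \<boxtimes>\<^bsub>D\<^esub> FA U2 (Ide E (FO U1 X))) \<bullet>\<^bsub>D\<^esub> (q \<boxtimes>\<^bsub>D\<^esub> Ide D (FO U2 (FO U1 X)))))"
      unfolding lam by (subst U2.target.interchange) (simp_all)
    also have "\<dots> = FA U2 (lam1 P X) \<bullet>\<^bsub>D\<^esub> ((lam2 (FO U1 P) (FO U1 X)
        \<bullet>\<^bsub>D\<^esub> (FA U2 p \<boxtimes>\<^bsub>D\<^esub> FA U2 (Ide E (FO U1 X)))) \<bullet>\<^bsub>D\<^esub> (q \<boxtimes>\<^bsub>D\<^esub> Ide D (FO U2 (FO U1 X))))"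
      by simp
    also have "lam2 (FO U1 P) (FO U1 X) \<bullet>\<^bsub>D\<^esub> (FA U2 p \<boxtimes>\<^bsub>D\<^esub> FA U2 (Ide E (FO U1 X)))
        = FA U2 (p \<boxtimes>\<^bsub>E\<^esub> Ide E (FO U1 X)) \<bullet>\<^bsub>D\<^esub> lam2 Q (FO U1 X)"
      by (rule U2.m_nat) (simp_all add: Hom_iff)
    also have "FA U2 (lam1 P X) \<bullet>\<^bsub>D\<^esub> ((FA U2 (p \<boxtimes>\<^bsub>E\<^esub> Ide E (FO U1 X)) \<bullet>\<^bsub>D\<^esub> lam2 Q (FO U1 X))
          \<bullet>\<^bsub>D\<^esub> (q \<boxtimes>\<^bsub>D\<^esub> Ide D (FO U2 (FO U1 X))))
        = FA U2 (lam1 P X \<bullet>\<^bsub>E\<^esub> (p \<boxtimes>\<^bsub>E\<^esub> Ide E (FO U1 X)))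
          \<bullet>\<^bsub>D\<^esub> (lam2 Q (FO U1 X) \<bullet>\<^bsub>D\<^esub> (q \<boxtimes>\<^bsub>D\<^esub> Ide D (FO U2 (FO U1 X))))"
      by (simp add: U2.cmp)
    also have "\<dots> = FA U2 (mpow C E U1 lam1 lam01 X (Suc (Suc n)))
        \<bullet>\<^bsub>D\<^esub> mpow E D U2 lam2 lam02 (FO U1 X) (Suc (Suc n))"
      by (simp add: P_def p_def q_def Q_def)
    finally show ?case .
  qed
qed

section \<open>Dual equivalences are fully faithful\<close>

context dual_equivalence
begin

lemma Dl_cmp:
  assumes "f \<in> Arr C" "g \<in> Arr C" "Src C g = Tgt C f"
  shows "FA (Dl d) (g \<bullet>\<^bsub>C\<^esub> f) = FA (Dl d) f \<bullet>\<^bsub>K\<^esub> FA (Dl d) g"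
  using to_dual.cmp[of g f] assms by simp

lemma Dr_cmp:
  assumes "f \<in> Arr K" "g \<in> Arr K" "Src K g = Tgt K f"
  shows "FA (Dr d) (g \<bullet>\<^bsub>K\<^esub> f) = FA (Dr d) f \<bullet>\<^bsub>C\<^esub> FA (Dr d) g"
  using from_dual.cmp[of g f] assms by simp

lemma Dl_inv: "is_iso C f \<Longrightarrow> inv_arr K (FA (Dl d) f) = FA (Dl d) (inv_arr C f)"
  using to_dual.inv_arr_map[of f] by simp

lemma Dr_iso: "is_iso K f \<Longrightarrow> is_iso C (FA (Dr d) f)"
  by (rule from_dual.iso_map) simp

lemma kap_iso: "X \<in> Obj C \<Longrightarrow> is_iso C (kap d X)"
  by (rule unit.component_iso)

lemma kap'_iso: "X \<in> Obj K \<Longrightarrow> is_iso K (kap' d X)"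
  by (rule counit.component_iso)

lemma kap_natural:
  "f \<in> Arr C \<Longrightarrow> kap d (Tgt C f) \<bullet>\<^bsub>C\<^esub> f = FA (Dr d) (FA (Dl d) f) \<bullet>\<^bsub>C\<^esub> kap d (Src C f)"
  using unit.natural[of f] by simp

lemma kap'_natural:
  "f \<in> Arr K \<Longrightarrow> kap' d (Tgt K f) \<bullet>\<^bsub>K\<^esub> f = FA (Dl d) (FA (Dr d) f) \<bullet>\<^bsub>K\<^esub> kap' d (Src K f)"
  using counit.natural[of f] by simp

text \<open>Naturality of \<open>kap\<close> exhibits \<open>f\<close> as a conjugate of its double
  dual, which depends on \<open>Dl f\<close> only.\<close>

lemma Dl_faithful:
  assumes "f \<in> Arr C" "g \<in> Arr C" "Src C f = Src C g" "Tgt C f = Tgt C g"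
    and eq: "FA (Dl d) f = FA (Dl d) g"
  shows "f = g"
proof (rule from_dual.target.iso_cancel_left)
  show "kap d (Tgt C f) \<bullet>\<^bsub>C\<^esub> f = kap d (Tgt C f) \<bullet>\<^bsub>C\<^esub> g"
    using kap_natural[of f] kap_natural[of g] assms by simp
qed (use assms in \<open>simp_all add: kap_iso\<close>)

lemma Dr_faithful:
  assumes "f \<in> Arr K" "g \<in> Arr K" "Src K f = Src K g" "Tgt K f = Tgt K g"
    and eq: "FA (Dr d) f = FA (Dr d) g"
  shows "f = g"
proof (rule to_dual.target.iso_cancel_left)
  show "kap' d (Tgt K f) \<bullet>\<^bsub>K\<^esub> f = kap' d (Tgt K f) \<bullet>\<^bsub>K\<^esub> g"
    using kap'_natural[of f] kap'_natural[of g] assms by simp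
qed (use assms in \<open>simp_all add: kap'_iso\<close>)

text \<open>The candidate is \<open>Dr g\<close> conjugated back along \<open>kap\<close>. This
  yields only that \<open>Dl f\<close> and \<open>g\<close> agree after \<open>Dr\<close>;
  faithfulness of \<open>Dr\<close>, which rests on \<open>kap'\<close>, completes the
  argument.\<close>

lemma Dl_full:
  assumes X: "X \<in> Obj C" "Y \<in> Obj C" and g: "g \<in> Hom K (FO (Dl d) Y) (FO (Dl d) X)"
  obtains f where "f \<in> Hom C X Y" "FA (Dl d) f = g"
proof -
  define f where "f = inv_arr C (kap d Y) \<bullet>\<^bsub>C\<^esub> FA (Dr d) g \<bullet>\<^bsub>C\<^esub> kap d X"
  have [simp]: "X \<in> Obj C" "Y \<in> Obj C" "g \<in> Arr K" "Src K g = FO (Dl d) Y" "Tgt K g = FO (Dl d) X"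
    using X g by (auto simp: Hom_iff)
  note [simp] = kap_iso
  have [simp]: "f \<in> Arr C" "Src C f = X" "Tgt C f = Y"
    by (simp_all add: f_def)
  have "kap d Y \<bullet>\<^bsub>C\<^esub> f = FA (Dr d) g \<bullet>\<^bsub>C\<^esub> kap d X"
    by (simp add: f_def)
  then have eq: "FA (Dr d) (FA (Dl d) f) \<bullet>\<^bsub>C\<^esub> kap d X = FA (Dr d) g \<bullet>\<^bsub>C\<^esub> kap d X"
    using kap_natural[of f] by simp
  have "FA (Dr d) (FA (Dl d) f) = FA (Dr d) g"
    by (rule from_dual.target.iso_cancel_right[OF _ _ _ _ _ eq]) simp_all
  then have "FA (Dl d) f = g"
    by (intro Dr_faithful) simp_all
  then show thesis
    using that[of f] by (simp add: Hom_iff)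
qed

text \<open>Full faithfulness reverses the factorization. The isomorphism \<open>q\<close> is there
  because \<open>rho\<close> starts at a tensor power of a dual rather than at the dual of a tensor
  power; it is cancelled in one direction and appended to the dual of \<open>s\<close> in the
  other.\<close>

lemma dual_factors_iff:
  assumes X: "X \<in> Obj C" and Y: "Y \<in> Obj C" and Z: "Z \<in> Obj C"
    and g: "g \<in> Hom C X Y" and p: "p \<in> Hom C X Z"
    and q: "is_iso K q" "q \<in> Hom K V (FO (Dl d) Y)"
  shows "(\<exists>s \<in> Hom K V (FO (Dl d) Z). FA (Dl d) g \<bullet>\<^bsub>K\<^esub> q = FA (Dl d) p \<bullet>\<^bsub>K\<^esub> s)
    \<longleftrightarrow> (\<exists>s \<in> Hom C Z Y. g = s \<bullet>\<^bsub>C\<^esub> p)"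
proof
  have [simp]: "g \<in> Arr C" "Src C g = X" "Tgt C g = Y" "p \<in> Arr C" "Src C p = X" "Tgt C p = Z"
    "q \<in> Arr K" "Src K q = V" "Tgt K q = FO (Dl d) Y"
    using g p q by (auto simp: Hom_iff)
  note [simp] = X Y Z q(1)
  show "\<exists>s \<in> Hom C Z Y. g = s \<bullet>\<^bsub>C\<^esub> p"
    if "\<exists>s \<in> Hom K V (FO (Dl d) Z). FA (Dl d) g \<bullet>\<^bsub>K\<^esub> q = FA (Dl d) p \<bullet>\<^bsub>K\<^esub> s"
  proof -
    from that obtain s where s: "s \<in> Hom K V (FO (Dl d) Z)"
      and eq: "FA (Dl d) g \<bullet>\<^bsub>K\<^esub> q = FA (Dl d) p \<bullet>\<^bsub>K\<^esub> s"
      by blast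
    have [simp]: "s \<in> Arr K" "Src K s = V" "Tgt K s = FO (Dl d) Z"
      using s by (auto simp: Hom_iff)
    have "s \<bullet>\<^bsub>K\<^esub> inv_arr K q \<in> Hom K (FO (Dl d) Y) (FO (Dl d) Z)"
      by (simp add: Hom_iff)
    then obtain r where r: "r \<in> Hom C Z Y" "FA (Dl d) r = s \<bullet>\<^bsub>K\<^esub> inv_arr K q"
      using Dl_full[OF Z Y] by blast
    have [simp]: "r \<in> Arr C" "Src C r = Z" "Tgt C r = Y"
      using r by (auto simp: Hom_iff)
    have "FA (Dl d) g = (FA (Dl d) g \<bullet>\<^bsub>K\<^esub> q) \<bullet>\<^bsub>K\<^esub> inv_arr K q"
      by simp
    also have "\<dots> = FA (Dl d) (r \<bullet>\<^bsub>C\<^esub> p)"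
      unfolding eq by (simp add: Dl_cmp r(2))
    finally have "g = r \<bullet>\<^bsub>C\<^esub> p"
      by (intro Dl_faithful) simp_all
    then show ?thesis
      using r(1) by blast
  qed
  show "\<exists>s \<in> Hom K V (FO (Dl d) Z). FA (Dl d) g \<bullet>\<^bsub>K\<^esub> q = FA (Dl d) p \<bullet>\<^bsub>K\<^esub> s"
    if "\<exists>s \<in> Hom C Z Y. g = s \<bullet>\<^bsub>C\<^esub> p"
  proof -
    from that obtain s where s: "s \<in> Hom C Z Y" "g = s \<bullet>\<^bsub>C\<^esub> p"
      by blast
    have [simp]: "s \<in> Arr C" "Src C s = Z" "Tgt C s = Y"
      using s by (auto simp: Hom_iff)
    show ?thesis
      by (rule bexI[of _ "FA (Dl d) s \<bullet>\<^bsub>K\<^esub> q"]) (simp_all add: Hom_iff s(2) Dl_cmp)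
  qed
qed

end

section \<open>The dual monad\<close>

text \<open>Exhibits the monad morphism as the dual of a single arrow, so that full faithfulness
  applies. Naturality pushes the double-dual isomorphisms to the two ends of \<open>eps2\<close>;
  those at the target are collected in \<open>theta\<close>, of which only invertibility is
  recorded.\<close>

lemma monad_morphism_T1_T_eq:
  assumes "dual_equivalence C Ch dC" "dual_equivalence D Dh dD" "dual_equivalence E Eh dE"
    and "is_functor C E U1" "is_functor E C F1" "adjunction D E F2 U2 eta2 eps2"
    and W: "W \<in> Obj Ch"
  defines "w \<equiv> FO (Dr dC) W"
  defines "Z \<equiv> FO (Dl dE) (FO U1 w)"
  obtains theta where "is_iso E theta" "theta \<in> Hom E (FO U1 w) (FO (Dr dE) Z)"
    "monad_morphism_T1_T Ch Eh dC dD dE F1 U1 F2 U2 eps2 W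
      = FA (Dl dC) (FA F1 (theta \<bullet>\<^bsub>E\<^esub> eps2 (FO U1 w)
          \<bullet>\<^bsub>E\<^esub> FA F2 (inv_arr D (kap dD (FO U2 (FO U1 w))))))"
proof
  interpret C: dual_equivalence C Ch dC by fact
  interpret D: dual_equivalence D Dh dD by fact
  interpret E: dual_equivalence E Eh dE by fact
  interpret U1: is_functor C E U1 by fact
  interpret F1: is_functor E C F1 by fact
  interpret adj2: adjunction D E F2 U2 eta2 eps2 by fact
  define z where "z = FO (Dr dE) Z"
  define u where "u = FO U1 w"
  define K where "K X = inv_arr D (kap dD X)" for X
  note [simp] = W C.kap_iso D.kap_iso E.kap_iso C.kap'_iso E.kap'_iso
    C.from_dual.target.iso_arr D.from_dual.target.iso_arr E.from_dual.target.iso_arr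
    E.to_dual.target.iso_arr
  have [simp]: "w \<in> Obj C" "u \<in> Obj E" "Z \<in> Obj Eh" "z \<in> Obj E"
    using C.from_dual.fobj E.from_dual.fobj E.to_dual.fobj by (simp_all add: w_def u_def Z_def z_def)
  have [simp]: "K X \<in> Arr D" "Tgt D (K X) = X" "Src D (K X) = FO (Dr dD) (FO (Dl dD) X)"
    "is_iso D (K X)" if "X \<in> Obj D" for X
    using that by (simp_all add: K_def D.from_dual.target.iso_inv_arr)
  \<comment> \<open>The path runs from \<open>u\<close> to \<open>z\<close>, to the double dual of
    \<open>z\<close>, and back to \<open>z\<close>. The last two factors form an automorphism of
    \<open>z\<close>, which a triangle identity would make trivial.\<close>
  let ?theta = "FA (Dr dE) (kap' dE Z) \<bullet>\<^bsub>E\<^esub> kap dE z \<bullet>\<^bsub>E\<^esub> kap dE u"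
  have zu: "z = FO (Dr dE) (FO (Dl dE) u)"
    by (simp add: z_def Z_def u_def)
  have [simp]: "FA (Dr dE) (kap' dE Z) \<in> Arr E"
    "Src E (FA (Dr dE) (kap' dE Z)) = FO (Dr dE) (FO (Dl dE) z)"
    "Tgt E (FA (Dr dE) (kap' dE Z)) = z"
    by (simp_all add: z_def)
  have [simp]: "kap dE u \<in> Arr E" "Src E (kap dE u) = u" "Tgt E (kap dE u) = z"
    by (simp_all add: zu)
  show "is_iso E ?theta"
    by (intro E.from_dual.target.iso_cmp E.Dr_iso) simp_all
  show "?theta \<in> Hom E (FO U1 w) (FO (Dr dE) Z)"
    by (simp add: Hom_iff u_def[symmetric] z_def[symmetric])
  \<comment> \<open>The dual of \<open>F1\<close> applies \<open>Dr dE\<close> first, so this is the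
    form in which the dual counit enters.\<close>
  have counit: "FA (Dr dE) (dual_counit Eh dE dD F2 U2 eps2 Z)
      = FA (Dr dE) (kap' dE Z) \<bullet>\<^bsub>E\<^esub> FA (Dr dE) (FA (Dl dE) (eps2 z \<bullet>\<^bsub>E\<^esub> FA F2 (K (FO U2 z))))"
    by (simp add: dual_counit_def dual_fcomp_def dual_nat_def z_def[symmetric] E.Dl_inv
        adj2.left.iso_map adj2.left.inv_arr_map K_def[symmetric] E.Dl_cmp E.Dr_cmp)
  define V where "V = FO (Dr dD) (FO (Dl dD) (FO U2 z))"
  have [simp]: "V \<in> Obj D"
    by (simp add: V_def)
  \<comment> \<open>The contribution of comparing the composite of the duals of \<open>U2\<close>
    and \<open>U1\<close> with the dual of \<open>U2 U1\<close>; it leads from the double dual of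
    \<open>U2 u\<close> to that of \<open>U2 z\<close>.\<close>
  define G where "G = FA (Dr dD) (FA (Dl dD) (FA U2 (kap dE u)))"
  have [simp]: "G \<in> Arr D" "Src D G = FO (Dr dD) (FO (Dl dD) (FO U2 u))" "Tgt D G = V"
    by (simp_all add: G_def V_def)
  have *: "FA (Dr dE) (FA (Dl dE) (eps2 z \<bullet>\<^bsub>E\<^esub> FA F2 (K (FO U2 z)))) \<bullet>\<^bsub>E\<^esub> kap dE (FO F2 V)
      = kap dE z \<bullet>\<^bsub>E\<^esub> eps2 z \<bullet>\<^bsub>E\<^esub> FA F2 (K (FO U2 z))"
    using E.kap_natural[of "eps2 z \<bullet>\<^bsub>E\<^esub> FA F2 (K (FO U2 z))"] by (simp add: V_def)
  \<comment> \<open>Naturality of \<open>kap dD\<close>, placed between inverses of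
    \<open>kap dD\<close> at both ends, moves \<open>K\<close> from \<open>z\<close> to
    \<open>u\<close>.\<close>
  have "K (FO U2 z) \<bullet>\<^bsub>D\<^esub> (G \<bullet>\<^bsub>D\<^esub> kap dD (FO U2 u)) \<bullet>\<^bsub>D\<^esub> K (FO U2 u)
      = K (FO U2 z) \<bullet>\<^bsub>D\<^esub> (kap dD (FO U2 z) \<bullet>\<^bsub>D\<^esub> FA U2 (kap dE u)) \<bullet>\<^bsub>D\<^esub> K (FO U2 u)"
    using D.kap_natural[of "FA U2 (kap dE u)"] by (simp add: G_def)
  then have K: "K (FO U2 z) \<bullet>\<^bsub>D\<^esub> G = FA U2 (kap dE u) \<bullet>\<^bsub>D\<^esub> K (FO U2 u)"
    by (simp add: K_def V_def)
  have "FA (Dr dE) (dual_counit Eh dE dD F2 U2 eps2 Z) \<bullet>\<^bsub>E\<^esub> kap dE (FO F2 V) \<bullet>\<^bsub>E\<^esub> FA F2 G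
    = FA (Dr dE) (kap' dE Z) \<bullet>\<^bsub>E\<^esub>
     (FA (Dr dE) (FA (Dl dE) (eps2 z \<bullet>\<^bsub>E\<^esub> FA F2 (K (FO U2 z)))) \<bullet>\<^bsub>E\<^esub> kap dE (FO F2 V)) \<bullet>\<^bsub>E\<^esub> FA F2 G"
    unfolding counit by (simp add: V_def)
  also have "\<dots> = FA (Dr dE) (kap' dE Z) \<bullet>\<^bsub>E\<^esub> kap dE z \<bullet>\<^bsub>E\<^esub> eps2 z \<bullet>\<^bsub>E\<^esub> FA F2 (K (FO U2 z) \<bullet>\<^bsub>D\<^esub> G)"
    unfolding * by (simp add: V_def adj2.left.cmp)
  also have "\<dots> = FA (Dr dE) (kap' dE Z) \<bullet>\<^bsub>E\<^esub> kap dE z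
      \<bullet>\<^bsub>E\<^esub> (eps2 z \<bullet>\<^bsub>E\<^esub> FA F2 (FA U2 (kap dE u))) \<bullet>\<^bsub>E\<^esub> FA F2 (K (FO U2 u))"
    unfolding K by (simp add: adj2.left.cmp)
  also have "eps2 z \<bullet>\<^bsub>E\<^esub> FA F2 (FA U2 (kap dE u)) = kap dE u \<bullet>\<^bsub>E\<^esub> eps2 u"
    using adj2.counit.natural[of "kap dE u"] by simp
  finally have S: "FA (Dr dE) (dual_counit Eh dE dD F2 U2 eps2 Z) \<bullet>\<^bsub>E\<^esub> kap dE (FO F2 V) \<bullet>\<^bsub>E\<^esub> FA F2 G
      = ?theta \<bullet>\<^bsub>E\<^esub> eps2 u \<bullet>\<^bsub>E\<^esub> FA F2 (K (FO U2 u))"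
    by simp
  have [simp]: "FA (Dr dE) (dual_counit Eh dE dD F2 U2 eps2 Z) \<in> Arr E"
    "Src E (FA (Dr dE) (dual_counit Eh dE dD F2 U2 eps2 Z)) = FO (Dr dE) (FO (Dl dE) (FO F2 V))"
    unfolding counit by (simp_all add: V_def)
  have "monad_morphism_T1_T Ch Eh dC dD dE F1 U1 F2 U2 eps2 W
      = FA (Dl dC) (FA F1 (FA (Dr dE) (dual_counit Eh dE dD F2 U2 eps2 Z) \<bullet>\<^bsub>E\<^esub> kap dE (FO F2 V) \<bullet>\<^bsub>E\<^esub> FA F2 G))"
    by (simp add: monad_morphism_T1_T_def dual_fcomp_def dual_functor_def w_def[symmetric]
        u_def[symmetric] Z_def[folded u_def, symmetric] z_def[symmetric] V_def[symmetric]
        G_def[symmetric] C.Dl_cmp F1.cmp)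
  then show "monad_morphism_T1_T Ch Eh dC dD dE F1 U1 F2 U2 eps2 W
      = FA (Dl dC) (FA F1 (?theta \<bullet>\<^bsub>E\<^esub> eps2 (FO U1 w)
          \<bullet>\<^bsub>E\<^esub> FA F2 (inv_arr D (kap dD (FO U2 (FO U1 w))))))"
    unfolding S by (simp only: K_def u_def)
qed

text \<open>The counterpart for \<open>rho\<close>: all of it except the structure isomorphism at
  \<open>B\<close> is the dual of one arrow. The inverse of \<open>kap\<close> at \<open>U w\<close>
  appears here exactly as in the monad morphism, which makes the two comparable.\<close>

lemma dual_morphism_eq:
  fixes eps lam lam0 k n a
  assumes "monoidal_dual_equivalence C Ch dC" "dual_equivalence D Dh dD"
    and "is_functor D C F" "is_functor C D U"
    and A: "A \<in> Obj C" and B: "B \<in> Obj C"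
  defines "w \<equiv> FO (Dr dC) (tpow Ch (FO (Dl dC) A) k)"
    and "t \<equiv> transpose C F eps (tpow C B n) (monoidal_conjugate C D U lam lam0 A k B n a)"
  assumes t: "t \<in> Hom C (FO F (FO U (tpow C A k))) (tpow C B n)"
  obtains y where "is_iso C y" "y \<in> Hom C w (tpow C A k)"
    "dual_morphism C D Ch dC dD F U eps lam lam0 A k B n a
      = FA (Dl dC) (t \<bullet>\<^bsub>C\<^esub> FA F (FA U y \<bullet>\<^bsub>D\<^esub> inv_arr D (kap dD (FO U w))))
        \<bullet>\<^bsub>Ch\<^esub> mpow (op_mcat C) Ch (Dl dC) (dm dC) (dm0 dC) B n"
proof
  interpret C: monoidal_dual_equivalence C Ch dC by fact
  interpret D: dual_equivalence D Dh dD by fact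
  interpret F: is_functor D C F by fact
  interpret U: is_functor C D U by fact
  define X where "X = tpow C A k"
  define mA where "mA = mpow (op_mcat C) Ch (Dl dC) (dm dC) (dm0 dC) A k"
  define m where "m = mpow (op_mcat C) Ch (Dl dC) (dm dC) (dm0 dC) B n"
  define W where "W = tpow Ch (FO (Dl dC) A) k"
  define K where "K X = inv_arr D (kap dD X)" for X
  define r where "r = FA (Dr dC) (inv_arr Ch mA)"
  define X' where "X' = FO (Dr dC) (FO (Dl dC) X)"
  note [simp] = A B C.monoidal.source.tpow_obj[simplified] C.kap_iso D.kap_iso
    C.from_dual.target.iso_arr D.from_dual.target.iso_arr
  have [simp]: "X \<in> Obj C"
    by (simp add: X_def)
  have mA [simp]: "is_iso Ch mA" "mA \<in> Arr Ch" "Src Ch mA = W" "Tgt Ch mA = FO (Dl dC) X"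
    by (simp_all add: mA_def W_def X_def)
  have [simp]: "W \<in> Obj Ch"
    unfolding mA(3)[symmetric] by (rule C.to_dual.target.src_obj) simp
  have [simp]: "FO (Dr dC) W = w"
    by (simp add: W_def w_def)
  have [simp]: "w \<in> Obj C"
    using C.from_dual.fobj[of W] by simp
  have [simp]: "X' \<in> Obj C"
    by (simp add: X'_def)
  have [simp]: "K X \<in> Arr D" "Tgt D (K X) = X" "Src D (K X) = FO (Dr dD) (FO (Dl dD) X)"
    "is_iso D (K X)" if "X \<in> Obj D" for X
    using that by (simp_all add: K_def D.from_dual.target.iso_inv_arr)
  have [simp]: "is_iso C r" "r \<in> Arr C" "Src C r = w" "Tgt C r = X'"
    by (simp_all add: r_def X'_def C.Dr_iso C.to_dual.target.iso_inv_arr)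
  have [simp]: "Tgt C (kap dC X) = X'"
    by (simp add: X'_def)
  have [simp]: "m \<in> Arr Ch" "Tgt Ch m = FO (Dl dC) (tpow C B n)"
    by (simp_all add: m_def)
  have [simp]: "t \<in> Arr C" "Src C t = FO F (FO U X)" "Tgt C t = tpow C B n"
    using t by (simp_all add: X_def Hom_iff)
  \<comment> \<open>Here \<open>r\<close> removes the dual tensor structure at \<open>A\<close> and
    the inverse of \<open>kap\<close> removes the remaining double dual, leading from
    \<open>w\<close> to the tensor power of \<open>A\<close>.\<close>
  let ?y = "inv_arr C (kap dC X) \<bullet>\<^bsub>C\<^esub> r"
  show "is_iso C ?y"
    by (rule C.from_dual.target.iso_cmp) (simp_all add: C.from_dual.target.iso_inv_arr)
  show "?y \<in> Hom C w (tpow C A k)"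
    by (simp add: Hom_iff X_def[symmetric])
  define G where "G = FA (Dr dD) (FA (Dl dD) (FA U r))"
  have [simp]: "G \<in> Arr D" "Src D G = FO (Dr dD) (FO (Dl dD) (FO U w))"
    "Tgt D G = FO (Dr dD) (FO (Dl dD) (FO U X'))"
    by (simp_all add: G_def)
  have "K (FO U X') \<bullet>\<^bsub>D\<^esub> (G \<bullet>\<^bsub>D\<^esub> kap dD (FO U w)) \<bullet>\<^bsub>D\<^esub> K (FO U w)
      = K (FO U X') \<bullet>\<^bsub>D\<^esub> (kap dD (FO U X') \<bullet>\<^bsub>D\<^esub> FA U r) \<bullet>\<^bsub>D\<^esub> K (FO U w)"
    using D.kap_natural[of "FA U r"] by (simp add: G_def)
  then have K: "K (FO U X') \<bullet>\<^bsub>D\<^esub> G = FA U r \<bullet>\<^bsub>D\<^esub> K (FO U w)"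
    by (simp add: K_def)
  have i: "inv_arr Ch (FA (Dl dC) (FA F (kap dD (FO U X')))) = FA (Dl dC) (FA F (K (FO U X')))"
    "inv_arr Ch (FA (Dl dC) (FA F (FA U (kap dC X)))) = FA (Dl dC) (FA F (FA U (inv_arr C (kap dC X))))"
    by (simp_all add: C.Dl_inv F.iso_map U.iso_map F.inv_arr_map U.inv_arr_map K_def)
  have "dual_morphism C D Ch dC dD F U eps lam lam0 A k B n a
      = FA (Dl dC) (FA F G) \<bullet>\<^bsub>Ch\<^esub> FA (Dl dC) (FA F (K (FO U X')))
        \<bullet>\<^bsub>Ch\<^esub> FA (Dl dC) (FA F (FA U (inv_arr C (kap dC X)))) \<bullet>\<^bsub>Ch\<^esub> FA (Dl dC) t \<bullet>\<^bsub>Ch\<^esub> m"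
    by (simp add: dual_morphism_def dual_monad_def dual_functor_def dual_fcomp_def dual_app_def
        X_def[symmetric] X'_def[symmetric] mA_def[symmetric] m_def[symmetric] r_def[symmetric]
        G_def[symmetric] t_def[symmetric] i)
  also have "\<dots> = FA (Dl dC) (t \<bullet>\<^bsub>C\<^esub> FA F (FA U (inv_arr C (kap dC X)))
      \<bullet>\<^bsub>C\<^esub> FA F (K (FO U X') \<bullet>\<^bsub>D\<^esub> G)) \<bullet>\<^bsub>Ch\<^esub> m"
    by (simp add: C.Dl_cmp F.cmp)
  also have "\<dots> = FA (Dl dC) (t \<bullet>\<^bsub>C\<^esub> FA F (FA U ?y \<bullet>\<^bsub>D\<^esub> K (FO U w))) \<bullet>\<^bsub>Ch\<^esub> m"
    unfolding K by (simp add: F.cmp U.cmp)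
  finally show "dual_morphism C D Ch dC dD F U eps lam lam0 A k B n a
      = FA (Dl dC) (t \<bullet>\<^bsub>C\<^esub> FA F (FA U ?y \<bullet>\<^bsub>D\<^esub> inv_arr D (kap dD (FO U w))))
        \<bullet>\<^bsub>Ch\<^esub> mpow (op_mcat C) Ch (Dl dC) (dm dC) (dm0 dC) B n"
    by (simp only: K_def m_def)
qed

section \<open>Lifting of \<open>a\<close> compared with factorization of \<open>rho\<close>\<close>

theorem proposition3p10:
  fixes C :: "('oc, 'ac) mcat" and D :: "('od, 'ad) mcat" and E :: "('oe, 'ae) mcat"
    and Ch :: "('och, 'ach) mcat" and Dh :: "('odh, 'adh) cat" and Eh :: "('oeh, 'aeh) cat"
    and dC :: "('oc, 'ac, 'och, 'ach) mdual_eq"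
    and dD :: "('od, 'ad, 'odh, 'adh) dual_eq"
    and dE :: "('oe, 'ae, 'oeh, 'aeh) dual_eq"
    and F :: "('od, 'ad, 'oc, 'ac) fctr" and U :: "('oc, 'ac, 'od, 'ad) fctr"
    and F1 :: "('oe, 'ae, 'oc, 'ac) fctr" and U1 :: "('oc, 'ac, 'oe, 'ae) fctr"
    and F2 :: "('od, 'ad, 'oe, 'ae) fctr" and U2 :: "('oe, 'ae, 'od, 'ad) fctr"
    and k n :: nat
  assumes C: "strict_monoidal_category C" and D: "strict_monoidal_category D"
    and E: "monoidal_category E"
    and dualC: "monoidal_dual_equivalence C Ch dC"
    and dualD: "dual_equivalence D Dh dD"
    and dualE: "dual_equivalence E Eh dE"
    and adj: "adjunction D C F U eta eps"
    and adj1: "adjunction E C F1 U1 eta1 eps1"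
    and adj2: "adjunction D E F2 U2 eta2 eps2"
    and adj_splits: "adjunction_splits D C F U eta eps F1 U1 eta1 eps1 F2 U2 eta2 eps2"
    and U_monoidal: "strong_monoidal_functor C D U lam lam0"
    and U1_monoidal: "strong_monoidal_functor C E U1 lam1 lam01"
    and U2_monoidal: "strong_monoidal_functor E D U2 lam2 lam02"
    and lam_splits: "monoidal_structure_splits C D lam lam0 U1 lam1 lam01 U2 lam2 lam02"
    and A: "A \<in> Obj C" and B: "B \<in> Obj C"
    and a: "a \<in> Hom D (tpow D (FO U A) k) (tpow D (FO U B) n)"
  defines "rho \<equiv> dual_morphism C D Ch dC dD F U eps lam lam0 A k B n a"
    and "Ahk \<equiv> tpow Ch (FO (Dl dC) A) k" and "Bhn \<equiv> tpow Ch (FO (Dl dC) B) n"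
    and "T1 \<equiv> dual_monad dC dE F1 U1"
  shows "(\<exists>b \<in> Hom E (tpow E (FO U1 A) k) (tpow E (FO U1 B) n).
            a = inv_arr D (mpow E D U2 lam2 lam02 (FO U1 B) n)
                \<bullet>\<^bsub>D\<^esub> FA U2 b \<bullet>\<^bsub>D\<^esub> mpow E D U2 lam2 lam02 (FO U1 A) k)
     \<longleftrightarrow> (\<exists>sigma \<in> Hom Ch Bhn (FO T1 Ahk).
            rho = monad_morphism_T1_T Ch Eh dC dD dE F1 U1 F2 U2 eps2 Ahk \<bullet>\<^bsub>Ch\<^esub> sigma)"
proof -
  interpret C: monoidal_dual_equivalence C Ch dC by (rule dualC)
  interpret D: dual_equivalence D Dh dD by (rule dualD)
  interpret E: dual_equivalence E Eh dE by (rule dualE)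
  interpret adj: adjunction D C F U eta eps by (rule adj)
  interpret adj1: adjunction E C F1 U1 eta1 eps1 by (rule adj1)
  interpret adj2: adjunction D E F2 U2 eta2 eps2 by (rule adj2)
  interpret U: strong_monoidal_functor C D U lam lam0 by (rule U_monoidal)
  interpret U1: strong_monoidal_functor C E U1 lam1 lam01 by (rule U1_monoidal)
  interpret U2: strong_monoidal_functor E D U2 lam2 lam02 by (rule U2_monoidal)
  define X where "X = tpow C A k"
  define Y where "Y = tpow C B n"
  define w where "w = FO (Dr dC) Ahk"
  define h where "h = monoidal_conjugate C D U lam lam0 A k B n a"
  define t where "t = transpose C F eps Y h"
  define m where "m = mpow (op_mcat C) Ch (Dl dC) (dm dC) (dm0 dC) B n"
  define N where "N = inv_arr D (kap dD (FO U w))"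
  note [simp] = C.from_dual.target.iso_arr D.from_dual.target.iso_arr E.from_dual.target.iso_arr
  have [simp]: "FO U Z = FO U2 (FO U1 Z)" if "Z \<in> Obj C" for Z
    using adj_splits that by (simp add: adjunction_splits_def functor_eq_def)
  have [simp]: "FA U f = FA U2 (FA U1 f)" if "f \<in> Arr C" for f
    using adj_splits that by (simp add: adjunction_splits_def functor_eq_def)
  have [simp]: "FO F Z = FO F1 (FO F2 Z)" if "Z \<in> Obj D" for Z
    using adj_splits that by (simp add: adjunction_splits_def functor_eq_def)
  have [simp]: "FA F f = FA F1 (FA F2 f)" if "f \<in> Arr D" for f
    using adj_splits that by (simp add: adjunction_splits_def functor_eq_def)
  have [simp]: "X \<in> Obj C" "Y \<in> Obj C" "A \<in> Obj C" "B \<in> Obj C"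
    using A B by (simp_all add: X_def Y_def)
  have Ahk [simp]: "Ahk \<in> Obj Ch"
    by (simp add: Ahk_def)
  have [simp]: "w \<in> Obj C"
    using C.from_dual.fobj[of Ahk] by (simp add: w_def)
  have [simp]: "is_iso D N" "N \<in> Arr D" "Tgt D N = FO U2 (FO U1 w)"
    "Src D N = FO (Dr dD) (FO (Dl dD) (FO U2 (FO U1 w)))"
    by (simp_all add: N_def D.kap_iso D.from_dual.target.iso_inv_arr)
  have m: "is_iso Ch m" "m \<in> Hom Ch Bhn (FO (Dl dC) Y)"
    by (simp_all add: m_def Bhn_def Y_def Hom_iff)

  let ?pA = "mpow C E U1 lam1 lam01 A k" and ?qA = "mpow E D U2 lam2 lam02 (FO U1 A) k"
  let ?pB = "mpow C E U1 lam1 lam01 B n" and ?qB = "mpow E D U2 lam2 lam02 (FO U1 B) n"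
  have h_eq: "h = (FA U2 ?pB \<bullet>\<^bsub>D\<^esub> ?qB) \<bullet>\<^bsub>D\<^esub> a \<bullet>\<^bsub>D\<^esub> inv_arr D (FA U2 ?pA \<bullet>\<^bsub>D\<^esub> ?qA)"
    unfolding h_def monoidal_conjugate_def
    by (simp add: mpow_splits[OF U1_monoidal U2_monoidal lam_splits])
  have a': "a \<in> Hom D (tpow D (FO U2 (FO U1 A)) k) (tpow D (FO U2 (FO U1 B)) n)"
    using a by simp
  then have [simp]: "a \<in> Arr D" "Src D a = tpow D (FO U2 (FO U1 A)) k"
    "Tgt D a = tpow D (FO U2 (FO U1 B)) n"
    by (auto simp: Hom_iff)
  have h: "h \<in> Hom D (FO U2 (FO U1 X)) (FO U2 (FO U1 Y))"
    unfolding h_def monoidal_conjugate_def by (simp add: X_def Y_def Hom_iff)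
  then have [simp]: "h \<in> Arr D" "Src D h = FO U2 (FO U1 X)" "Tgt D h = FO U2 (FO U1 Y)"
    by (auto simp: Hom_iff)
  have t: "t \<in> Hom C (FO F1 (FO F2 (FO U2 (FO U1 X)))) Y"
    using adj.transpose_arr[of "FO U X" Y h] h by (simp add: t_def)
  \<comment> \<open>Since \<open>eps Y\<close> is \<open>eps1 Y\<close> after \<open>F1\<close> of
    \<open>eps2 (U1 Y)\<close>, transposing in two stages agrees with transposing under
    \<open>F -| U\<close>.\<close>
  have t_eq: "transpose C F1 eps1 Y (transpose E F2 eps2 (FO U1 Y) h) = t"
    using adj_splits by (simp add: t_def transpose_def adjunction_splits_def adj1.left.cmp)

  obtain y where y: "is_iso C y" "y \<in> Hom C w X"
    and rho: "rho = FA (Dl dC) (t \<bullet>\<^bsub>C\<^esub> FA F (FA U y \<bullet>\<^bsub>D\<^esub> N)) \<bullet>\<^bsub>Ch\<^esub> m"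
  proof (rule dual_morphism_eq[OF dualC dualD adj.left.is_functor_axioms
        adj.right.is_functor_axioms, where eps = eps and lam = lam and ?lam0.0 = lam0
        and A = A and k = k and B = B and n = n and a = a])
    show "transpose C F eps (tpow C B n) (monoidal_conjugate C D U lam lam0 A k B n a)
        \<in> Hom C (FO F (FO U (tpow C A k))) (tpow C B n)"
      using t by (simp add: t_def h_def Y_def[symmetric] X_def[symmetric])
  qed (use that in \<open>simp_all add: rho_def w_def N_def X_def Y_def t_def h_def m_def Ahk_def\<close>)
  obtain theta where theta: "is_iso E theta"
      "theta \<in> Hom E (FO U1 w) (FO (Dr dE) (FO (Dl dE) (FO U1 w)))"
    and M: "monad_morphism_T1_T Ch Eh dC dD dE F1 U1 F2 U2 eps2 Ahk
      = FA (Dl dC) (FA F1 (theta \<bullet>\<^bsub>E\<^esub> eps2 (FO U1 w) \<bullet>\<^bsub>E\<^esub> FA F2 N))"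
    using monad_morphism_T1_T_eq[OF C.dual_equivalence_axioms dualD dualE
        adj1.right.is_functor_axioms adj1.left.is_functor_axioms adj2 Ahk]
    by (auto simp: w_def[symmetric] N_def)
  define z where "z = FO (Dr dE) (FO (Dl dE) (FO U1 w))"
  have [simp]: "y \<in> Arr C" "Src C y = w" "Tgt C y = X" "theta \<in> Arr E" "Src E theta = FO U1 w"
    "Tgt E theta = z" "t \<in> Arr C" "Src C t = FO F1 (FO F2 (FO U2 (FO U1 X)))" "Tgt C t = Y"
    "z \<in> Obj E"
    using y theta t by (auto simp: Hom_iff z_def)
  note [simp] = y(1) theta(1) adj1.right.iso_map adj2.right.iso_map adj1.left.iso_map adj2.left.iso_map
  \<comment> \<open>The common source factor: \<open>rho\<close> shows it directly, and the monad
    morphism acquires it once naturality of \<open>eps2\<close> along \<open>U1 y\<close> replaces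
    \<open>w\<close> by \<open>X\<close>.\<close>
  define v where "v = FA U2 (FA U1 y) \<bullet>\<^bsub>D\<^esub> N"
  have v [simp]: "is_iso D v" "v \<in> Arr D" "Src D v = Src D N" "Tgt D v = FO U2 (FO U1 X)"
    by (simp_all add: v_def D.from_dual.target.iso_cmp)
  \<comment> \<open>Compensates at the target for that replacement: \<open>theta\<close> after the
    inverse of the \<open>U1 y\<close> that naturality produces.\<close>
  define u where "u = theta \<bullet>\<^bsub>E\<^esub> inv_arr E (FA U1 y)"
  have [simp]: "is_iso E u" "u \<in> Arr E" "Src E u = FO U1 X" "Tgt E u = z"
    by (simp_all add: u_def E.from_dual.target.iso_cmp E.from_dual.target.iso_inv_arr)
  have "eps2 (FO U1 X) \<bullet>\<^bsub>E\<^esub> FA F2 v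
      = (eps2 (FO U1 X) \<bullet>\<^bsub>E\<^esub> FA F2 (FA U2 (FA U1 y))) \<bullet>\<^bsub>E\<^esub> FA F2 N"
    by (simp add: v_def adj2.left.cmp)
  also have "\<dots> = (FA U1 y \<bullet>\<^bsub>E\<^esub> eps2 (FO U1 w)) \<bullet>\<^bsub>E\<^esub> FA F2 N"
    using adj2.counit.natural[of "FA U1 y"] by simp
  finally have "theta \<bullet>\<^bsub>E\<^esub> eps2 (FO U1 w) \<bullet>\<^bsub>E\<^esub> FA F2 N = u \<bullet>\<^bsub>E\<^esub> eps2 (FO U1 X) \<bullet>\<^bsub>E\<^esub> FA F2 v"
    by (simp add: u_def)
  then have M': "monad_morphism_T1_T Ch Eh dC dD dE F1 U1 F2 U2 eps2 Ahk
      = FA (Dl dC) (FA F1 u \<bullet>\<^bsub>C\<^esub> FA F1 (eps2 (FO U1 X)) \<bullet>\<^bsub>C\<^esub> FA F1 (FA F2 v))"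
    unfolding M by (simp add: adj1.left.cmp)
  have rho': "rho = FA (Dl dC) (t \<bullet>\<^bsub>C\<^esub> FA F1 (FA F2 v)) \<bullet>\<^bsub>Ch\<^esub> m"
    unfolding rho by (simp add: v_def)

  have "(\<exists>b \<in> Hom E (tpow E (FO U1 A) k) (tpow E (FO U1 B) n).
        a = inv_arr D ?qB \<bullet>\<^bsub>D\<^esub> FA U2 b \<bullet>\<^bsub>D\<^esub> ?qA)
      \<longleftrightarrow> (\<exists>b \<in> Hom E (FO U1 X) (FO U1 Y). h = FA U2 b)"
    unfolding h_eq
    by (rule adj2.right.lifts_iff_conjugate_lifts) (use a' in \<open>simp_all add: Hom_iff X_def Y_def\<close>)
  also have "\<dots> \<longleftrightarrow> (\<exists>g \<in> Hom C (FO F1 (FO U1 X)) Y. t = g \<bullet>\<^bsub>C\<^esub> FA F1 (eps2 (FO U1 X)))"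
    using lift_iff_transpose_factors[OF adj1 adj2 _ _ h] by (simp add: t_eq)
  \<comment> \<open>The isomorphism \<open>F1 F2 v\<close> cancels on the right, and
    \<open>F1 u\<close> is absorbed into \<open>s\<close>.\<close>
  also have "\<dots> \<longleftrightarrow> (\<exists>s \<in> Hom C (FO F1 z) Y. t \<bullet>\<^bsub>C\<^esub> FA F1 (FA F2 v)
      = s \<bullet>\<^bsub>C\<^esub> FA F1 u \<bullet>\<^bsub>C\<^esub> FA F1 (eps2 (FO U1 X)) \<bullet>\<^bsub>C\<^esub> FA F1 (FA F2 v))"
    by (rule C.from_dual.target.factors_iff_cancel_iso[symmetric]) (simp_all add: Hom_iff)
  \<comment> \<open>Dualizing reverses the order, so the unknown factor now acts first; it also
    takes in the structure isomorphism \<open>m\<close> at \<open>B\<close>.\<close>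
  also have "\<dots> \<longleftrightarrow> (\<exists>s \<in> Hom Ch Bhn (FO (Dl dC) (FO F1 z)).
      rho = monad_morphism_T1_T Ch Eh dC dD dE F1 U1 F2 U2 eps2 Ahk \<bullet>\<^bsub>Ch\<^esub> s)"
    unfolding M' rho'
    by (rule C.dual_factors_iff[symmetric, OF _ _ _ _ _ m]) (simp_all add: Hom_iff)
  \<comment> \<open>Unfolding \<open>T1\<close> at \<open>Ahk\<close> gives the dual of
    \<open>F1 z\<close>, because \<open>z\<close> is the double dual of \<open>U1 w\<close>.\<close>
  finally show ?thesis
    by (simp add: T1_def dual_monad_def dual_functor_def w_def z_def)
qed

end
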